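(* Let $F:\mathbb{R}^n\to\mathbb{R}^m$ be continuously differentiable, $R>0$, $x_0\in\mathbb{R}^n$, and let $f:[0,R)\to\mathbb{R}$ be a majorant function for $F$ on $B(x_0,R)$. Let $\alpha>0$, $\xi>0$ and define $f_{\xi,\alpha}:[0,R)\to\mathbb{R}$, $f_{\xi,\alpha}(t):=\xi+(\alpha-1)t+\alpha f(t)$. Assume that there exists $t_*\in(0,R)$ such that $f_{\xi,\alpha}(t)>0$ for all $t\in(0,t_* )$ and $f_{\xi,\alpha}(t_* )=0$. Then the sequence $$t_0=0,\qquad t_{k+1}=t_k-\frac{f_{\xi,\alpha}(t_k)}{f_{\xi,\alpha}'(t_k)},\quad k=0,1,\ldots,$$ is well defined, strictly increasing, contained in $[0,t_* )$, and converges $Q$-linearly to $t_*$. Let further $\eta\in[1,\infty)$, $\Delta\in(0,\infty]$, and let $h:\mathbb{R}^m\to\mathbb{R}$ be convex with nonempty set of minimizers $C$. Suppose that $x_0$ is a quasi-regular point of the inclusion $F(x)\in C$ with quasi-regular radius $r_{x_0}$ and quasi-regular bound function $\beta_{x_0}$. If $d(F(x_0),C)>0$, $t_*\le r_{x_0}$, $$\Delta\ge\xi\ge\eta\beta_{x_0}(0)\,d(F(x_0),C)\quad\text{and}\quad \alpha\ge\sup\left\{\frac{\eta\beta_{x_0}(t)}{\eta\beta_{x_0}(t)[f'(t)+1]+1}:\ \xi\le t<t_*\right\},$$ then every sequence $\{x_k\}$ generated by the Gauss-Newton algorithm associated with $(\Delta,\eta,x_0)$ is contained in $B(x_0,t_*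 )$, satisfies $$F(x_k)+F'(x_k)(x_{k+1}-x_k)\in C,\qquad k=0,1,\ldots,$$ $$\|x_{k+1}-x_k\|\le t_{k+1}-t_k,\quad k=0,1,\ldots,\qquad \|x_{k+1}-x_k\|\le\frac{t_{k+1}-t_k}{(t_k-t_{k-1})^2}\|x_k-x_{k-1}\|^2,\quad k=1,2,\ldots,$$ converges to a point $x_*\in B[x_0,t_*]$ with $F(x_* )\in C$, and $$\|x_*-x_k\|\le t_*-t_k,\qquad k=0,1,\ldots;$$ the convergence is $R$-linear. If, additionally, $f_{\xi,\alpha}'(t_* )<0$, then $\{t_k\}$ converges $Q$-quadratically to $t_*$ and $\{x_k\}$ converges $R$-quadratically to $x_*$.
   Context: $\mathbb{R}^n,\mathbb{R}^m$ carry norms $\|\cdot\|$, and linear maps carry the operator norm. $B(x,r)$, $B[x,r]$ are open and closed balls. $d(x,W)=\inf\{\|x-w\|:w\in W\}$. Majorant function: a twice-differentiable $f:[0,R)\to\mathbb{R}$ is a majorant function for $F$ on $B(x_0,R)$ if $\|F'(y)-F'(x)\|\le f'(\|y-x\|+\|x-x_0\|)-f'(\|x-x_0\|)$ for all $x,y\in B(x_0,R)$ with $\|x-x_0\|+\|y-x\|<R$, and moreover $f(0)=0$, $f'(0)=-1$, and $f'$ is convex and strictly increasing. $D_C(x):=\{d\in\mathbb{R}^n: F(x)+F'(x)d\in C\}$. Quasi-regularity: $x_0$ is a quasi-regular point of the inclusion $F(x)\in C$ if there exist $r\in(0,+\infty)$ and an increasing (i.e. nondecreasing) function $\beta:[0,r)\to(0,+\infty)$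 such that ( * ) $D_C(x)\ne\emptyset$ and $d(0,D_C(x))\le\beta(\|x-x_0\|)\,d(F(x),C)$ for all $x\in B(x_0,r)$. The quasi-regular radius $r_{x_0}$ is the supremum of all $r$ for which some increasing $\beta:[0,r)\to(0,+\infty)$ satisfies ( * ). The quasi-regular bound function is $\beta_{x_0}(t):=\inf\{\beta(t)\}$, $t\in[0,r_{x_0})$, the infimum being over all increasing $\beta:[0,r_{x_0})\to(0,+\infty)$ satisfying ( * ) with $r=r_{x_0}$. Gauss-Newton algorithm associated with $(\Delta,\eta,x_0)$: let $D_\Delta(x)$ be the set of minimizers of $d\mapsto h(F(x)+F'(x)d)$ over $\{d\in\mathbb{R}^n:\|d\|\le\Delta\}$ (over all of $\mathbb{R}^n$ if $\Delta=+\infty$). For $k=0,1,\ldots$: if $0\in D_\Delta(x_k)$, stop; otherwise choose $d_k\in D_\Delta(x_k)$ with $\|d_k\|\le\eta\, d(0,D_\Delta(x_k))$ and set $x_{k+1}=x_k+d_k$. The generated sequence is regarded as infinite: it is any sequence with $x_{k+1}-x_k\in D_\Delta(x_k)$ and $\|x_{k+1}-x_k\|\le\eta\, d(0,D_\Delta(x_k))$ for all $k$ (so after a stop it stays constant). Convergence rates: $s_k\to s_*$ $Q$-linearly if there is $c\in(0,1)$ with $\|s_{k+1}-s_*\|\le c\|s_k-s_*\|$ for all $k$; $Q$-quadratically if $s_k\to s_*$ and there is $c>0$ with $\|s_{k+1}-s_*\|\le c\|s_k-s_*\|^2$ for all $k$; $x_k\to x_*$ $R$-linearly ($R$-quadratically)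 if $\|x_k-x_*\|\le\epsilon_k$ for a sequence $\epsilon_k\ge0$ converging $Q$-linearly ($Q$-quadratically) to $0$. *)

theory Defs
  imports "HOL-Analysis.Analysis"
begin

text \<open>
  The spaces are finite-dimensional real normed spaces, so that the norms are arbitrary and
  not only Euclidean; finite-dimensionality is a hypothesis of the theorem.  The derivative of a
  map \<open>F\<close> is a function \<open>F'\<close> into the bounded linear maps, whose norm is the operator norm.
  Radii that may be infinite have type \<^typ>\<open>ereal\<close>.
\<close>

text \<open>Derivative of a function on \<open>[0, R)\<close>, one-sided at the left endpoint.\<close>

definition ival_deriv :: "real \<Rightarrow> (real \<Rightarrow> real) \<Rightarrow> real \<Rightarrow> real" where
  "ival_deriv R f t = vector_derivative f (at t within {0..<R})"

definition majorant_function ::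
  "('a::real_normed_vector \<Rightarrow> 'a \<Rightarrow>\<^sub>L 'b::real_normed_vector) \<Rightarrow> 'a \<Rightarrow> real \<Rightarrow> (real \<Rightarrow> real) \<Rightarrow> bool"
where
  "majorant_function F' x0 R f \<longleftrightarrow>
     f differentiable_on {0..<R} \<and> ival_deriv R f differentiable_on {0..<R} \<and>
     (\<forall>x \<in> ball x0 R. \<forall>y \<in> ball x0 R. norm (x - x0) + norm (y - x) < R \<longrightarrow>
        norm (F' y - F' x)
          \<le> ival_deriv R f (norm (y - x) + norm (x - x0)) - ival_deriv R f (norm (x - x0))) \<and>
     f 0 = 0 \<and> ival_deriv R f 0 = -1 \<and>
     convex_on {0..<R} (ival_deriv R f) \<and> strict_mono_on {0..<R} (ival_deriv R f)"

definition minimizers :: "('b \<Rightarrow> real) \<Rightarrow> 'b set" where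
  "minimizers h = {y. is_arg_min h (\<lambda>_. True) y}"

definition linearized_solutions ::
  "('a::real_normed_vector \<Rightarrow> 'b::real_normed_vector) \<Rightarrow> ('a \<Rightarrow> 'a \<Rightarrow>\<^sub>L 'b) \<Rightarrow> 'b set \<Rightarrow> 'a \<Rightarrow> 'a set"
where
  "linearized_solutions F F' C x = {d. F x + blinfun_apply (F' x) d \<in> C}"

text \<open>
  \<open>quasi_regular_with F F' C x0 r \<beta>\<close>: the function \<open>\<beta>\<close>, of which only the values on \<open>[0, r)\<close>
  matter, is a nondecreasing positive bound function for the inclusion on the ball of radius
  \<open>r\<close>, the whole space if \<open>r = \<infinity>\<close>.
\<close>

definition quasi_regular_with ::
  "('a::real_normed_vector \<Rightarrow> 'b::real_normed_vector) \<Rightarrow> ('a \<Rightarrow> 'a \<Rightarrow>\<^sub>L 'b) \<Rightarrow> 'b set \<Rightarrow> 'a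
    \<Rightarrow> ereal \<Rightarrow> (real \<Rightarrow> real) \<Rightarrow> bool"
where
  "quasi_regular_with F F' C x0 r \<beta> \<longleftrightarrow>
     mono_on {t. 0 \<le> t \<and> ereal t < r} \<beta> \<and>
     (\<forall>t. 0 \<le> t \<and> ereal t < r \<longrightarrow> 0 < \<beta> t) \<and>
     (\<forall>x. ereal (norm (x - x0)) < r \<longrightarrow>
        linearized_solutions F F' C x \<noteq> {} \<and>
        infdist 0 (linearized_solutions F F' C x) \<le> \<beta> (norm (x - x0)) * infdist (F x) C)"

definition quasi_regular_point ::
  "('a::real_normed_vector \<Rightarrow> 'b::real_normed_vector) \<Rightarrow> ('a \<Rightarrow> 'a \<Rightarrow>\<^sub>L 'b) \<Rightarrow> 'b set \<Rightarrow> 'a \<Rightarrow> bool"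
where
  "quasi_regular_point F F' C x0 \<longleftrightarrow>
     (\<exists>r::real. 0 < r \<and> (\<exists>\<beta>. quasi_regular_with F F' C x0 (ereal r) \<beta>))"

definition quasi_regular_radius ::
  "('a::real_normed_vector \<Rightarrow> 'b::real_normed_vector) \<Rightarrow> ('a \<Rightarrow> 'a \<Rightarrow>\<^sub>L 'b) \<Rightarrow> 'b set \<Rightarrow> 'a \<Rightarrow> ereal"
where
  "quasi_regular_radius F F' C x0 =
     (SUP r \<in> {r::real. 0 < r \<and> (\<exists>\<beta>. quasi_regular_with F F' C x0 (ereal r) \<beta>)}. ereal r)"

definition quasi_regular_bound ::
  "('a::real_normed_vector \<Rightarrow> 'b::real_normed_vector) \<Rightarrow> ('a \<Rightarrow> 'a \<Rightarrow>\<^sub>L 'b) \<Rightarrow> 'b set \<Rightarrow> 'a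
    \<Rightarrow> real \<Rightarrow> real"
where
  "quasi_regular_bound F F' C x0 t =
     Inf {\<beta> t | \<beta>. quasi_regular_with F F' C x0 (quasi_regular_radius F F' C x0) \<beta>}"

definition GN_directions ::
  "('a::real_normed_vector \<Rightarrow> 'b::real_normed_vector) \<Rightarrow> ('a \<Rightarrow> 'a \<Rightarrow>\<^sub>L 'b) \<Rightarrow> ('b \<Rightarrow> real) \<Rightarrow> ereal
    \<Rightarrow> 'a \<Rightarrow> 'a set"
where
  "GN_directions F F' h \<Delta> x =
     {d. is_arg_min (\<lambda>d. h (F x + blinfun_apply (F' x) d)) (\<lambda>d. ereal (norm d) \<le> \<Delta>) d}"

text \<open>A stopped run is continued as a constant sequence: once \<open>0\<close> is an admissible direction,
  the second condition forces the step to be \<open>0\<close>.\<close>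

definition GN_sequence ::
  "('a::real_normed_vector \<Rightarrow> 'b::real_normed_vector) \<Rightarrow> ('a \<Rightarrow> 'a \<Rightarrow>\<^sub>L 'b) \<Rightarrow> ('b \<Rightarrow> real) \<Rightarrow> ereal
    \<Rightarrow> real \<Rightarrow> 'a \<Rightarrow> (nat \<Rightarrow> 'a) \<Rightarrow> bool"
where
  "GN_sequence F F' h \<Delta> \<eta> x0 x \<longleftrightarrow>
     x 0 = x0 \<and>
     (\<forall>k. x (Suc k) - x k \<in> GN_directions F F' h \<Delta> (x k) \<and>
          norm (x (Suc k) - x k) \<le> \<eta> * infdist 0 (GN_directions F F' h \<Delta> (x k)))"

definition Q_linear :: "(nat \<Rightarrow> 'a::real_normed_vector) \<Rightarrow> 'a \<Rightarrow> bool" where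
  "Q_linear s l \<longleftrightarrow>
     (\<exists>c::real. 0 < c \<and> c < 1 \<and> (\<forall>k. norm (s (Suc k) - l) \<le> c * norm (s k - l)))"

definition Q_quadratic :: "(nat \<Rightarrow> 'a::real_normed_vector) \<Rightarrow> 'a \<Rightarrow> bool" where
  "Q_quadratic s l \<longleftrightarrow>
     s \<longlonglongrightarrow> l \<and> (\<exists>c::real. 0 < c \<and> (\<forall>k. norm (s (Suc k) - l) \<le> c * (norm (s k - l))\<^sup>2))"

definition R_linear :: "(nat \<Rightarrow> 'a::real_normed_vector) \<Rightarrow> 'a \<Rightarrow> bool" where
  "R_linear x l \<longleftrightarrow>
     (\<exists>e::nat \<Rightarrow> real. (\<forall>k. 0 \<le> e k \<and> norm (x k - l) \<le> e k) \<and> Q_linear e 0)"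

definition R_quadratic :: "(nat \<Rightarrow> 'a::real_normed_vector) \<Rightarrow> 'a \<Rightarrow> bool" where
  "R_quadratic x l \<longleftrightarrow>
     (\<exists>e::nat \<Rightarrow> real. (\<forall>k. 0 \<le> e k \<and> norm (x k - l) \<le> e k) \<and> Q_quadratic e 0)"

end

theory Submission
  imports Defs
begin

text \<open>
  Write \<open>C\<close> for the minimizers of \<open>h\<close>, \<open>n\<^sub>k\<close> for the length of the \<open>k\<close>-th Gauss-Newton step
  and \<open>T\<^sub>k = t\<^sub>k\<^sub>+\<^sub>1 - t\<^sub>k\<close>.  By induction the linearized inclusion at \<open>x\<^sub>k\<close> has a solution
  of length at most \<open>\<Delta>\<close>, so that every Gauss-Newton direction solves it.  Hence the distance of
  \<open>F x\<^sub>k\<^sub>+\<^sub>1\<close> to \<open>C\<close> is at most the linearization error of \<open>F\<close> at \<open>x\<^sub>k\<close>; by convexity of \<open>f'\<close>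
  this is at most \<open>(n\<^sub>k / T\<^sub>k)\<^sup>2\<close> times the linearization error of \<open>f\<close> at \<open>t\<^sub>k\<close>, which equals
  \<open>g t\<^sub>k\<^sub>+\<^sub>1 / \<alpha>\<close> because \<open>t\<close> is a Newton sequence.  The bound on \<open>\<alpha>\<close> says that the quasi-regular
  bound times \<open>\<eta> / \<alpha>\<close> is at most \<open>- 1 / g'\<close>, whence
  \<open>n\<^sub>k\<^sub>+\<^sub>1 \<le> (n\<^sub>k / T\<^sub>k)\<^sup>2 T\<^sub>k\<^sub>+\<^sub>1\<close>.  The scalar error at least halves in every step, so the \<open>T\<^sub>k\<close>
  decrease and stay below \<open>T\<^sub>0 = \<xi> \<le> \<Delta>\<close>.
\<close>

section \<open>Normed spaces with a finite spanning set: compactness and convex functions\<close>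

text \<open>After division by \<open>c\<close>, the norm is that of \<open>b\<close> plus an element
  of the subspace, hence at least the distance of \<open>b\<close> from it; the reciprocal of this
  distance serves as \<open>K\<close>. Control of the new coordinate permits induction on a spanning
  set, for an arbitrary norm.\<close>

lemma span_insert_coefficient_bound:
  fixes b :: "'a::real_normed_vector"
  assumes "closed (span B)" and "b \<notin> span B"
  obtains K where "K \<ge> 0" and "\<And>c w. w \<in> span B \<Longrightarrow> \<bar>c\<bar> \<le> K * norm (c *\<^sub>R b + w)"
proof
  have ne: "span B \<noteq> {}"
    using span_zero by blast
  define \<delta> where "\<delta> = infdist b (span B)"
  have \<delta>: "\<delta> > 0"
    unfolding \<delta>_def using infdist_pos_not_in_closed[OF assms(1) ne assms(2)] .
  show "1 / \<delta> \<ge> 0"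
    using \<delta> by simp
  fix c w assume w: "w \<in> span B"
  show "\<bar>c\<bar> \<le> 1 / \<delta> * norm (c *\<^sub>R b + w)"
  proof (cases "c = 0")
    case True
    then show ?thesis using \<delta> by simp
  next
    case False
    have "- ((1 / c) *\<^sub>R w) \<in> span B"
      using w span_scale span_neg by blast
    then have "\<delta> \<le> dist b (- ((1 / c) *\<^sub>R w))"
      unfolding \<delta>_def by (rule infdist_le)
    then have "\<bar>c\<bar> * \<delta> \<le> \<bar>c\<bar> * norm (b + (1 / c) *\<^sub>R w)"
      by (intro mult_left_mono) (auto simp: dist_norm)
    also have "\<dots> = norm (c *\<^sub>R (b + (1 / c) *\<^sub>R w))"
      by simp
    also have "c *\<^sub>R (b + (1 / c) *\<^sub>R w) = c *\<^sub>R b + w"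
      using False by (simp add: scaleR_right_distrib)
    finally show ?thesis
      using \<delta> by (simp add: field_simps)
  qed
qed

text \<open>A convergent sequence is bounded, so it lies in one compact piece together with its
  limit. This supplies the closedness that the coefficient bound asks for.\<close>

lemma closed_if_compact_Int_cball:
  fixes S :: "'a::real_normed_vector set"
  assumes "\<And>r. compact (S \<inter> cball 0 r)"
  shows "closed S"
  unfolding closed_sequential_limits
proof (intro allI impI, elim conjE)
  fix s l assume s: "\<forall>n. s n \<in> S" "s \<longlonglongrightarrow> l"
  have "Bseq s"
    using s(2) convergentI convergent_imp_Bseq by blast
  then obtain r where "\<And>n. norm (s n) \<le> r"
    by (auto simp: Bseq_def)
  then have "\<forall>n. s n \<in> S \<inter> cball 0 r"
    using s(1) by simp
  then show "l \<in> S"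
    using compact_imp_closed[OF assms] s(2) closed_sequentially by blast
qed

text \<open>Induction on \<open>B\<close>: the coefficient bound confines the coefficient of
  \<open>b\<close> and the remainder in \<open>span B\<close> to compact sets, so the ball is a
  closed part of a continuous image of a compact product.\<close>

lemma compact_span_Int_cball:
  fixes B :: "'a::real_normed_vector set"
  assumes "finite B"
  shows "compact (span B \<inter> cball 0 r)"
  using assms
proof (induction B arbitrary: r rule: finite_induct)
  case empty
  have "finite ({0 :: 'a} \<inter> cball 0 r)"
    by simp
  then show ?case
    unfolding span_empty by (rule finite_imp_compact)
next
  case (insert b B)
  have cl: "closed (span B)"
    using insert.IH by (rule closed_if_compact_Int_cball)
  show ?case
  proof (cases "b \<in> span B")
    case True
    then show ?thesis using insert.IH by (simp add: span_redundant)
  next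
    case False
    obtain K where K: "K \<ge> 0" "\<And>c w. w \<in> span B \<Longrightarrow> \<bar>c\<bar> \<le> K * norm (c *\<^sub>R b + w)"
      using span_insert_coefficient_bound[OF cl False] by blast
    \<comment> \<open>\<open>K * r\<close> bounds the coefficient of \<open>b\<close> in a vector of
      norm at most \<open>r\<close>; the triangle inequality then bounds the remainder.\<close>
    define T where "T = {- (K * r)..K * r} \<times> (span B \<inter> cball 0 (r + K * r * norm b))"
    have "compact T"
      unfolding T_def using insert.IH by (intro compact_Times) auto
    then have cT: "compact ((\<lambda>(c, w). c *\<^sub>R b + w) ` T)"
      by (intro compact_continuous_image) (simp_all add: case_prod_unfold continuous_intros)
    have "span (insert b B) \<inter> cball 0 r = (\<lambda>(c, w). c *\<^sub>R b + w) ` T \<inter> cball 0 r"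
    proof (intro equalityI subsetI)
      fix v assume v: "v \<in> span (insert b B) \<inter> cball 0 r"
      then obtain c where c: "v - c *\<^sub>R b \<in> span B"
        by (auto simp: span_breakdown_eq)
      have "\<bar>c\<bar> \<le> K * norm v"
        using K(2)[OF c, of c] by simp
      also have "\<dots> \<le> K * r"
        using K(1) v by (intro mult_left_mono) auto
      finally have cr: "\<bar>c\<bar> \<le> K * r" .
      have "norm (v - c *\<^sub>R b) \<le> norm v + \<bar>c\<bar> * norm b"
        using norm_triangle_ineq4[of v "c *\<^sub>R b"] by simp
      also have "\<dots> \<le> r + K * r * norm b"
        using v cr by (intro add_mono mult_right_mono) auto
      finally have "(c, v - c *\<^sub>R b) \<in> T"
        using c cr by (auto simp: T_def)
      then have "v \<in> (\<lambda>(c, w). c *\<^sub>R b + w) ` T"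
        by (rule rev_image_eqI) simp
      then show "v \<in> (\<lambda>(c, w). c *\<^sub>R b + w) ` T \<inter> cball 0 r"
        using v by blast
    next
      fix v assume "v \<in> (\<lambda>(c, w). c *\<^sub>R b + w) ` T \<inter> cball 0 r"
      then obtain c w where "v = c *\<^sub>R b + w" "w \<in> span B" "v \<in> cball 0 r"
        by (auto simp: T_def)
      then show "v \<in> span (insert b B) \<inter> cball 0 r"
        using span_breakdown_eq[of v b B] by (metis IntI add_diff_cancel_left')
    qed
    then show ?thesis
      using cT by (simp add: compact_Int_closed)
  qed
qed

text \<open>Induction on \<open>B\<close>: convexity bounds \<open>h\<close> on a segment of
  multiples of \<open>b\<close> by its endpoint values, the induction hypothesis bounds it on a ball
  of \<open>span B\<close>, and averaging combines the two.\<close>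

lemma convex_on_bdd_above_span_cball:
  fixes B :: "'a::real_normed_vector set" and h :: "'a \<Rightarrow> real"
  assumes "finite B" and h: "convex_on UNIV h"
  shows "bdd_above (h ` (span B \<inter> cball 0 r))"
  using assms(1)
proof (induction B arbitrary: r rule: finite_induct)
  case empty
  have "h ` (span {} \<inter> cball 0 r) \<subseteq> {h 0}"
    by auto
  then show ?case by (meson bdd_above_mono bdd_above_finite finite.intros)
next
  case (insert b B)
  show ?case
  proof (cases "b \<in> span B")
    case True
    then show ?thesis using insert.IH by (simp add: span_redundant)
  next
    case False
    have cl: "closed (span B)"
      using compact_span_Int_cball[OF insert.hyps(1)] by (rule closed_if_compact_Int_cball)
    obtain K where K: "K \<ge> 0" "\<And>c w. w \<in> span B \<Longrightarrow> \<bar>c\<bar> \<le> K * norm (c *\<^sub>R b + w)"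
      using span_insert_coefficient_bound[OF cl False] by blast
    \<comment> \<open>The endpoints are those of a segment that contains every
      \<open>(2 * c) *\<^sub>R b\<close> occurring below; the factor 2 is there because the vector
      is split as a midpoint.\<close>
    define M where "M = max (h (- (2 * (K * r)) *\<^sub>R b)) (h ((2 * (K * r)) *\<^sub>R b))"
    obtain N where N: "\<And>w. w \<in> span B \<Longrightarrow> norm w \<le> 2 * (r + K * r * norm b) \<Longrightarrow> h w \<le> N"
      using insert.IH[of "2 * (r + K * r * norm b)"] unfolding bdd_above_def ball_simps
      by (metis IntI mem_cball_0)
    show ?thesis
    proof (rule bdd_aboveI2)
      fix v assume v: "v \<in> span (insert b B) \<inter> cball 0 r"
      then obtain c where c: "v - c *\<^sub>R b \<in> span B"
        by (auto simp: span_breakdown_eq)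
      have "\<bar>c\<bar> \<le> K * norm v"
        using K(2)[OF c, of c] by simp
      also have "\<dots> \<le> K * r"
        using K(1) v by (intro mult_left_mono) auto
      finally have cr: "\<bar>c\<bar> \<le> K * r" .
      have "norm (v - c *\<^sub>R b) \<le> norm v + \<bar>c\<bar> * norm b"
        using norm_triangle_ineq4[of v "c *\<^sub>R b"] by simp
      also have "\<dots> \<le> r + K * r * norm b"
        using v cr by (intro add_mono mult_right_mono) auto
      finally have w: "h (2 *\<^sub>R (v - c *\<^sub>R b)) \<le> N"
        using N[of "2 *\<^sub>R (v - c *\<^sub>R b)"] c span_scale by auto
      have "h ((2 * c) *\<^sub>R b) \<le> M"
      \<comment> \<open>In the degenerate case the segment is the origin alone and
        \<open>\<tau>\<close> would divide by zero.\<close>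
      proof (cases "K * r = 0")
        case True
        then have "c = 0" using cr by linarith
        then show ?thesis unfolding M_def True by simp
      next
        case False
        then have pos: "K * r > 0" using cr by linarith
        \<comment> \<open>The relative position of \<open>2 * c\<close> between
          \<open>- (2 * (K * r))\<close> and \<open>2 * (K * r)\<close>.\<close>
        define \<tau> where "\<tau> = (c + K * r) / (2 * (K * r))"
        have \<tau>_eq: "2 * (K * r) * \<tau> = c + K * r"
          using pos unfolding \<tau>_def by (intro nonzero_mult_div_cancel_left[THEN trans[OF times_divide_eq_right]]) linarith
        have \<tau>: "0 \<le> \<tau>" "\<tau> \<le> 1"
          using pos cr unfolding \<tau>_def by (simp_all add: divide_le_eq_1_pos del: mult_pos_pos)
        have "(1 - \<tau>) * (- (2 * (K * r))) + \<tau> * (2 * (K * r)) = 2 * c"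
          using \<tau>_eq by (simp add: algebra_simps)
        then have "(1 - \<tau>) *\<^sub>R (- (2 * (K * r)) *\<^sub>R b) + \<tau> *\<^sub>R ((2 * (K * r)) *\<^sub>R b) = (2 * c) *\<^sub>R b"
          unfolding scaleR_scaleR scaleR_add_left[symmetric] by simp
        then have "h ((2 * c) *\<^sub>R b) \<le>
            (1 - \<tau>) * h (- (2 * (K * r)) *\<^sub>R b) + \<tau> * h ((2 * (K * r)) *\<^sub>R b)"
          using convex_onD[OF h \<tau>, of "- (2 * (K * r)) *\<^sub>R b" "(2 * (K * r)) *\<^sub>R b"] by simp
        also have "\<dots> \<le> (1 - \<tau>) * M + \<tau> * M"
          using \<tau> by (intro add_mono mult_left_mono) (auto simp: M_def)
        finally show ?thesis by (simp add: algebra_simps)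
      qed
      \<comment> \<open>\<open>v\<close> is the midpoint of \<open>2 c b\<close> and a bounded element of \<open>span B\<close>.\<close>
      moreover have "h v \<le> (1 - 1/2) * h ((2 * c) *\<^sub>R b) + 1/2 * h (2 *\<^sub>R (v - c *\<^sub>R b))"
        using convex_onD[OF h, of "1/2" "(2 * c) *\<^sub>R b" "2 *\<^sub>R (v - c *\<^sub>R b)"]
        by (simp add: scaleR_right_diff_distrib)
      ultimately show "h v \<le> M / 2 + N / 2"
        using w by simp
    qed
  qed
qed

lemma compact_if_span_finite:
  fixes B S :: "'a::real_normed_vector set"
  assumes "finite B" and "span B = UNIV" and "closed S" and "bounded S"
  shows "compact S"
proof -
  obtain r where "\<forall>x\<in>S. norm x \<le> r"
    using assms(4) unfolding bounded_iff by blast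
  then have "(span B \<inter> cball 0 r) \<inter> S = S"
    using assms(2) by auto
  then show ?thesis
    using compact_Int_closed[OF compact_span_Int_cball[OF assms(1), of r] assms(3)] by simp
qed

text \<open>Any \<open>q\<close> in \<open>S\<close> cuts out a compact piece, the points no farther
  from \<open>a\<close> than \<open>q\<close>; a nearest point of that piece is nearest in all of
  \<open>S\<close>.\<close>

lemma infdist_attained_if_span_finite:
  fixes B S :: "'a::real_normed_vector set"
  assumes "finite B" and "span B = UNIV" and "closed S" and "S \<noteq> {}"
  obtains p where "p \<in> S" and "infdist a S = dist a p"
proof -
  obtain q where q: "q \<in> S" using assms(4) by blast
  have "compact (S \<inter> cball a (dist a q))"
    using assms by (intro compact_if_span_finite[OF assms(1,2)]) auto
  moreover have "q \<in> S \<inter> cball a (dist a q)"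
    using q by simp
  ultimately obtain p where p: "p \<in> S" "dist a p \<le> dist a q"
      "\<And>y. y \<in> S \<Longrightarrow> dist a y \<le> dist a q \<Longrightarrow> dist a p \<le> dist a y"
    using continuous_attains_inf[of "S \<inter> cball a (dist a q)" "dist a",
        OF _ _ continuous_on_dist[OF continuous_on_const continuous_on_id]]
    by (metis Int_iff empty_iff mem_cball)
  have "dist a p \<le> dist a y" if "y \<in> S" for y
    using p(2) p(3)[OF that] by linarith
  then have "dist a p \<le> infdist a S"
    unfolding infdist_notempty[OF assms(4)] using assms(4) by (intro cINF_greatest)
  then show ?thesis
    using that[OF p(1)] infdist_le[OF p(1), of a] by simp
qed

text \<open>A convex function that is bounded on an open ball is continuous there. The upper bound
  comes from the preceding induction; the lower bound \<open>m\<close> will be the minimum of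
  \<open>h\<close>.\<close>

lemma continuous_on_convex_if_span_finite:
  fixes B :: "'a::real_normed_vector set" and h :: "'a \<Rightarrow> real"
  assumes "finite B" and "span B = UNIV" and "convex_on UNIV h" and "\<And>y. m \<le> h y"
  shows "continuous_on UNIV h"
proof -
  have "isCont h y" for y
  proof -
    obtain M where M: "\<And>z. norm z \<le> norm y + 1 \<Longrightarrow> h z \<le> M"
      using convex_on_bdd_above_span_cball[OF assms(1,3), of "norm y + 1"]
      unfolding assms(2) bdd_above_def ball_simps by (metis IntI UNIV_I mem_cball_0)
    have "\<bar>h z\<bar> \<le> \<bar>M\<bar> + \<bar>m\<bar>" if "z \<in> ball 0 (norm y + 1)" for z
      using M[of z] assms(4)[of z] that by auto
    moreover have "convex_on (ball 0 (norm y + 1)) h"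
      using assms(3) by (rule convex_on_subset) auto
    ultimately have "continuous_on (ball 0 (norm y + 1)) h"
      by (intro convex_on_bounded_continuous) auto
    then show ?thesis
      using continuous_on_eq_continuous_at[OF open_ball, of 0 "norm y + 1" h] by simp
  qed
  then show ?thesis
    by (simp add: continuous_at_imp_continuous_on)
qed

section \<open>The scalar Newton sequence of a function with convex, strictly increasing
  derivative\<close>

text \<open>Applied later with \<open>r = t_star\<close>. The condition \<open>pos\<close> includes
  the point 0, where the \<open>g\<close> of the theorem takes the value \<xi>.\<close>

locale newton_convex_deriv =
  fixes g g' :: "real \<Rightarrow> real" and R r :: real and t :: "nat \<Rightarrow> real"
  assumes deriv: "\<And>s. s \<in> {0..<R} \<Longrightarrow> (g has_real_derivative g' s) (at s within {0..<R})"
    and convex: "convex_on {0..<R} g'"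
    and strict_mono_deriv: "strict_mono_on {0..<R} g'"
    and r_pos: "0 < r" and r_less: "r < R"
    and pos: "\<And>s. 0 \<le> s \<Longrightarrow> s < r \<Longrightarrow> 0 < g s"
    and root: "g r = 0"
    and t_0: "t 0 = 0"
    and t_Suc: "\<And>k. t (Suc k) = t k - g (t k) / g' (t k)"
begin

lemma mean_value:
  assumes "0 \<le> u" "u < v" "v < R"
  obtains z where "u < z" "z < v" "g v - g u = g' z * (v - u)"
proof -
  have "\<exists>z\<in>{u<..<v}. g v - g u = g' z * (v - u)"
    using assms(2)
  proof (rule mvt_simple)
    fix s assume "u \<le> s" "s \<le> v"
    then have "(g has_real_derivative g' s) (at s within {0..<R})"
      using assms by (intro deriv) auto
    moreover have "{u..v} \<subseteq> {0..<R}"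
      using assms by auto
    ultimately show "(g has_derivative (*) (g' s)) (at s within {u..v})"
      unfolding has_field_derivative_def by (rule has_derivative_subset)
  qed
  then show ?thesis using that by auto
qed

lemma deriv_less: "0 \<le> u \<Longrightarrow> u < v \<Longrightarrow> v < R \<Longrightarrow> g' u < g' v"
  using strict_mono_deriv by (auto simp: strict_mono_on_def)

lemma tangent_below:
  assumes "0 \<le> u" "u < v" "v < R"
  shows "g u + g' u * (v - u) < g v"
proof -
  obtain z where z: "u < z" "z < v" "g v - g u = g' z * (v - u)"
    using mean_value[OF assms] .
  then have "g' u * (v - u) < g' z * (v - u)"
    using assms deriv_less[of u z] by (intro mult_strict_right_mono) auto
  then show ?thesis using z by linarith
qed

lemma deriv_le_chord:
  assumes "0 \<le> u" "u \<le> s" "s \<le> v" "u < v" "v < R"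
  shows "g' s \<le> g' u + (g' v - g' u) / (v - u) * (s - u)"
proof -
  have "convex_on {u..v} g'"
    using convex by (rule convex_on_subset) (use assms in auto)
  then show ?thesis
    using convex_onD_Icc'[of u v g' s] assms by simp
qed

text \<open>The trapezoidal rule: a convex \<open>g'\<close> lies below its chord on the interval,
  and the integral of the chord gives the right-hand side. The factor 1/2 is what makes the Newton
  error halve.\<close>

lemma tangent_error_le:
  assumes "0 \<le> u" "u < v" "v < R"
  shows "g v - g u - g' u * (v - u) \<le> (g' v - g' u) / 2 * (v - u)"
proof -
  define m where "m = (g' v - g' u) / (v - u)"
  \<comment> \<open>An antiderivative of the chord minus \<open>g\<close>; its derivative is
    nonnegative on the interval.\<close>
  define \<psi> where "\<psi> = (\<lambda>s. g' u * (s - u) + m / 2 * (s - u)\<^sup>2 - g s)"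
  have "\<exists>z\<in>{u<..<v}. \<psi> v - \<psi> u = (g' u + m * (z - u) - g' z) * (v - u)"
    using assms(2)
  proof (rule mvt_simple)
    fix s assume s: "u \<le> s" "s \<le> v"
    then have "(g has_real_derivative g' s) (at s within {0..<R})"
      using assms by (intro deriv) auto
    moreover have "{u..v} \<subseteq> {0..<R}"
      using assms by auto
    ultimately have "(g has_real_derivative g' s) (at s within {u..v})"
      by (rule has_field_derivative_subset)
    then have "(\<psi> has_real_derivative g' u + m * (s - u) - g' s) (at s within {u..v})"
      unfolding \<psi>_def by (auto intro!: derivative_eq_intros)
    then show "(\<psi> has_derivative (*) (g' u + m * (s - u) - g' s)) (at s within {u..v})"
      by (simp add: has_field_derivative_def)
  qed
  then obtain z where z: "u < z" "z < v" "\<psi> v - \<psi> u = (g' u + m * (z - u) - g' z) * (v - u)"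
    by auto
  have "g' u + m * (z - u) - g' z \<ge> 0"
    using deriv_le_chord[of u z v] z assms by (simp add: m_def)
  then have "(g' u + m * (z - u) - g' z) * (v - u) \<ge> 0"
    using assms by simp
  then have "\<psi> u \<le> \<psi> v"
    using z by linarith
  moreover have "m / 2 * (v - u)\<^sup>2 = (g' v - g' u) / 2 * (v - u)"
  proof -
    have "m * (v - u) = g' v - g' u"
      using assms by (simp add: m_def)
    then show ?thesis by (simp add: power2_eq_square)
  qed
  ultimately show ?thesis by (simp add: \<psi>_def)
qed

text \<open>The graph lies above its tangents, so a nonnegative slope at \<open>s\<close> would
  force \<open>g r > g s > 0\<close>.\<close>

lemma deriv_neg:
  assumes "0 \<le> s" "s < r"
  shows "g' s < 0"
proof (rule ccontr)
  assume "\<not> g' s < 0"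
  then have "0 \<le> g' s * (r - s)"
    using assms by simp
  then show False
    using tangent_below[of s r] pos[of s] assms r_less root by linarith
qed

text \<open>A positive slope at the root would make \<open>g\<close> negative just to the left of
  it.\<close>

lemma deriv_root_le: "g' r \<le> 0"
proof (rule ccontr)
  assume "\<not> g' r \<le> 0"
  then obtain d where d: "d > 0" "\<And>h. h > 0 \<Longrightarrow> r - h \<in> {0..<R} \<Longrightarrow> h < d \<Longrightarrow> g (r - h) < g r"
    using has_real_derivative_pos_inc_left[OF deriv[of r]] r_pos r_less by auto
  \<comment> \<open>The first argument keeps \<open>h\<close> below \<open>d\<close>, the second
    keeps \<open>r - h\<close> nonnegative.\<close>
  define h where "h = min (d / 2) r"
  have "g (r - h) < g r"
    using d(1) r_pos r_less by (intro d(2)) (auto simp: h_def)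
  moreover have "g (r - h) > 0"
    using d(1) r_pos by (intro pos) (auto simp: h_def)
  ultimately show False using root by simp
qed

text \<open>The tangent at \<open>s\<close> is still negative at \<open>r\<close>, so its zero lies
  before \<open>r\<close>. For the last claim, the new error times \<open>- g' s\<close> is exactly
  the tangent error at the root.\<close>

lemma newton_step:
  assumes "0 \<le> s" "s < r"
  shows "s < s - g s / g' s" and "s - g s / g' s < r"
    and "- g' s * (r - (s - g s / g' s)) \<le> (g' r - g' s) / 2 * (r - s)"
proof -
  have neg: "g' s < 0" and ps: "g s > 0"
    using deriv_neg pos assms by auto
  show "s < s - g s / g' s"
    using divide_pos_neg[OF ps neg] by simp
  have "g s + g' s * (r - s) < 0"
    using tangent_below[of s r] assms r_less root by simp
  then show "s - g s / g' s < r"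
    using neg by (simp add: field_simps)
  have "- g' s * (r - (s - g s / g' s)) = g r - g s - g' s * (r - s)"
    using neg root by (simp add: field_simps)
  then show "- g' s * (r - (s - g s / g' s)) \<le> (g' r - g' s) / 2 * (r - s)"
    using tangent_error_le[of s r] assms r_less by simp
qed

lemma t_bounds: "0 \<le> t k \<and> t k < r"
proof (induction k)
  case 0
  show ?case using t_0 r_pos by simp
next
  case (Suc k)
  then show ?case using newton_step[of "t k"] t_Suc[of k] by simp
qed

lemma t_less_Suc: "t k < t (Suc k)"
  using newton_step(1)[of "t k"] t_bounds[of k] t_Suc[of k] by simp

lemma strict_mono_t: "strict_mono t"
  by (simp add: strict_mono_Suc_iff t_less_Suc)

lemma deriv_t_neg: "g' (t k) < 0"
  using deriv_neg t_bounds by blast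

text \<open>Since \<open>g' r\<close> is nonpositive, \<open>g' r - g' (t k)\<close> is at most
  \<open>- g' (t k)\<close>, which cancels from the error estimate.\<close>

lemma t_Suc_le_half: "r - t (Suc k) \<le> 1 / 2 * (r - t k)"
proof -
  have "- g' (t k) * (r - t (Suc k)) \<le> (g' r - g' (t k)) / 2 * (r - t k)"
    using newton_step(3)[of "t k"] t_bounds[of k] t_Suc[of k] by simp
  also have "\<dots> \<le> - g' (t k) / 2 * (r - t k)"
    using deriv_root_le t_bounds[of k] by (intro mult_right_mono) auto
  finally have "- g' (t k) * (r - t (Suc k)) \<le> - g' (t k) * (1 / 2 * (r - t k))"
    by simp
  then show ?thesis
    using deriv_t_neg[of k] mult_le_cancel_left_pos[of "- g' (t k)"] by simp
qed

text \<open>A step covers at least half of the distance to \<open>r\<close>, and all that remains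
  afterwards is at most the other half.\<close>

lemma t_step_decreasing: "t (Suc (Suc k)) - t (Suc k) \<le> t (Suc k) - t k"
  using t_Suc_le_half[of k] t_bounds[of "Suc (Suc k)"] by simp

text \<open>This will keep every scalar step within the bound \<Delta> on the directions.\<close>

lemma t_step_le_first: "t (Suc k) - t k \<le> t 1"
proof (induction k)
  case 0
  show ?case using t_0 by simp
next
  case (Suc k)
  then show ?case using t_step_decreasing[of k] by simp
qed

lemma Q_linear_t: "Q_linear t r"
  unfolding Q_linear_def
proof (intro exI[of _ "1 / 2"] conjI allI)
  fix k show "norm (t (Suc k) - r) \<le> 1 / 2 * norm (t k - r)"
    using t_Suc_le_half[of k] t_bounds[of k] t_bounds[of "Suc k"] by simp
qed auto

lemma t_tendsto: "t \<longlonglongrightarrow> r"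
proof -
  have "r - t k \<le> (1 / 2) ^ k * r" for k
  proof (induction k)
    case 0
    show ?case using t_0 by simp
  next
    case (Suc k)
    then show ?case using t_Suc_le_half[of k] by simp
  qed
  then have "norm (t k - r) \<le> (1 / 2) ^ k * r" for k
    using t_bounds[of k] by simp
  then have "\<forall>\<^sub>F k in sequentially. norm (t k - r) \<le> (1 / 2) ^ k * r"
    by (rule always_eventually[OF allI])
  moreover have "(\<lambda>k. (1 / 2) ^ k * r) \<longlonglongrightarrow> 0"
    by (rule tendsto_mult_left_zero[OF LIMSEQ_realpow_zero]) simp_all
  ultimately have "(\<lambda>k. t k - r) \<longlonglongrightarrow> 0"
    by (rule Lim_null_comparison)
  then show ?thesis by (rule LIM_zero_cancel)
qed

text \<open>With \<open>g' r < 0\<close> the divisors \<open>- g' (t k)\<close> stay above the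
  positive number \<open>- g' r\<close>, so it suffices to bound \<open>g' r - g' (t k)\<close> by a
  multiple of the error.\<close>

lemma Q_quadratic_t:
  assumes "g' r < 0"
  shows "Q_quadratic t r"
proof -
  \<comment> \<open>A point strictly between \<open>r\<close> and \<open>R\<close>, so that
    \<open>g'\<close> has a chord to the right of the root.\<close>
  define v where "v = (r + R) / 2"
  have v: "r < v" "v < R" using r_less by (auto simp: v_def)
  define m where "m = (g' v - g' r) / (v - r)"
  have m: "m > 0"
    unfolding m_def using deriv_less[of r v] v r_pos by simp
  have "r - t (Suc k) \<le> m / (2 * - g' r) * (r - t k)\<^sup>2" for k
  proof -
    have b: "0 \<le> t k" "t k < r" "t (Suc k) < r" using t_bounds by auto
    \<comment> \<open>A chord of the convex \<open>g'\<close> ending at \<open>r\<close> is no steeper than one starting at \<open>r\<close>,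
      so no second derivative is needed.\<close>
    have slope: "g' r - g' (t k) \<le> m * (r - t k)"
    proof -
      define s where "s = (g' v - g' (t k)) / (v - t k)"
      have "g' r \<le> g' (t k) + s * (r - t k)"
        using deriv_le_chord[of "t k" r v] b v by (simp add: s_def)
      moreover have "g' v = g' (t k) + s * (v - t k)"
        using b v by (simp add: s_def)
      ultimately have le: "s * (v - r) \<le> g' v - g' r"
        and "g' r - g' (t k) \<le> s * (r - t k)"
        by (auto simp: algebra_simps)
      moreover have "s \<le> m"
        using le v by (simp add: m_def field_simps)
      ultimately show ?thesis
        using b mult_right_mono[of s m "r - t k"] by linarith
    qed
    have "- g' r * (r - t (Suc k)) \<le> - g' (t k) * (r - t (Suc k))"
      using deriv_less[of "t k" r] b r_less by (intro mult_right_mono) auto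
    also have "\<dots> \<le> (g' r - g' (t k)) / 2 * (r - t k)"
      using newton_step(3)[of "t k"] b t_Suc[of k] by simp
    also have "\<dots> \<le> m * (r - t k) / 2 * (r - t k)"
      using slope b by (intro mult_right_mono divide_right_mono) auto
    finally have "- g' r * (r - t (Suc k)) \<le> m / 2 * (r - t k)\<^sup>2"
      by (simp add: power2_eq_square)
    then show ?thesis
      using assms by (simp add: field_simps)
  qed
  then have "norm (t (Suc k) - r) \<le> m / (2 * - g' r) * (norm (t k - r))\<^sup>2" for k
    using t_bounds[of "Suc k"] by (simp add: power2_commute)
  moreover have "m / (2 * - g' r) > 0"
    using m assms by (intro divide_pos_pos) auto
  ultimately show ?thesis
    unfolding Q_quadratic_def using t_tendsto by blast
qed

end

section \<open>Derivatives on the half-open interval\<close>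

lemma has_real_derivative_ival_deriv:
  assumes "f differentiable_on {0..<R}" and "s \<in> {0..<R}"
  shows "(f has_real_derivative ival_deriv R f s) (at s within {0..<R})"
proof -
  have "f differentiable (at s within {0..<R})"
    using assms by (simp add: differentiable_on_def)
  then show ?thesis
    by (simp add: ival_deriv_def has_real_derivative_iff_has_vector_derivative vector_derivative_works)
qed

lemma ival_deriv_eq:
  assumes "(f has_real_derivative D) (at s within {0..<R})" and "s \<in> {0..<R}"
  shows "ival_deriv R f s = D"
proof -
  have "s islimpt {0..<R}"
    using assms(2) by (simp add: islimpt_Ico)
  then have "at s within {0..<R} \<noteq> bot"
    by (simp add: trivial_limit_within)
  then show ?thesis
    using assms(1) vector_derivative_within
    by (auto simp: ival_deriv_def has_real_derivative_iff_has_vector_derivative)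
qed

section \<open>Quasi-regular radius and quasi-regular bound function\<close>

text \<open>The radius is only a supremum, so a bound function on the whole of \<open>[0, r)\<close> has to be
  assembled: take one plus the largest quotient of the two distances over the closed ball.
  Without it, the infimum defining \<^const>\<open>quasi_regular_bound\<close> could be over the empty set.\<close>

lemma ex_quasi_regular_with_radius:
  "\<exists>\<beta>. quasi_regular_with F F' C x0 (quasi_regular_radius F F' C x0) \<beta>"
proof -
  let ?r = "quasi_regular_radius F F' C x0"
  let ?d = "\<lambda>x. infdist 0 (linearized_solutions F F' C x)"
  \<comment> \<open>Division by zero gives \<open>q x = 0\<close> where \<open>F x\<close> has
    distance 0 from \<open>C\<close>; there every bound function forces \<open>?d x = 0\<close>, so
    nothing is lost.\<close>
  define q where "q = (\<lambda>x. ?d x / infdist (F x) C)"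
  define b where "b = (\<lambda>t. 1 + (SUP x\<in>cball x0 t. q x))"
  \<comment> \<open>A number below the supremum lies below some admissible radius, whose bound
    function \<open>\<gamma>\<close> is then at hand locally.\<close>
  have ex: "\<exists>r \<gamma>. t < r \<and> quasi_regular_with F F' C x0 (ereal r) \<gamma>" if "ereal t < ?r" for t
    using that unfolding quasi_regular_radius_def less_SUP_iff by auto
  have q_nonneg: "q x \<ge> 0" for x
    by (simp add: q_def infdist_nonneg)
  have bdd: "bdd_above (q ` cball x0 t)" if t: "ereal t < ?r" for t
  proof -
    obtain r \<gamma> where r: "t < r" and \<gamma>: "quasi_regular_with F F' C x0 (ereal r) \<gamma>"
      using ex[OF t] by blast
    have "q x \<le> \<gamma> t" if x: "x \<in> cball x0 t" for x
    proof -
      have xt: "norm (x - x0) \<le> t" using x by (simp add: dist_norm norm_minus_commute)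
      then have t0: "0 \<le> t" using norm_ge_zero order_trans by blast
      have le: "?d x \<le> \<gamma> (norm (x - x0)) * infdist (F x) C"
        using \<gamma> xt r by (auto simp: quasi_regular_with_def)
      have m: "\<gamma> (norm (x - x0)) \<le> \<gamma> t" and pos: "0 < \<gamma> t"
        using \<gamma> xt r t0 by (auto simp: quasi_regular_with_def mono_on_def)
      show ?thesis
      proof (cases "infdist (F x) C = 0")
        case True
        then show ?thesis using pos by (simp add: q_def)
      next
        case False
        then have "infdist (F x) C > 0"
          using infdist_nonneg[of "F x" C] by linarith
        then show ?thesis
          using le m by (simp add: q_def divide_le_eq order_trans[OF le mult_right_mono[OF m]])
      qed
    qed
    then show ?thesis by (rule bdd_aboveI2)
  qed
  have q_le: "q x \<le> (SUP x\<in>cball x0 t. q x)" if "ereal t < ?r" "norm (x - x0) \<le> t" for x t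
    using bdd[OF that(1)] that(2)
    by (intro cSUP_upper) (auto simp: dist_norm norm_minus_commute)
  have "mono_on {t. 0 \<le> t \<and> ereal t < ?r} b"
    unfolding mono_on_def
  proof (intro allI impI, elim conjE)
    fix s t assume st: "s \<in> {t. 0 \<le> t \<and> ereal t < ?r}" "t \<in> {t. 0 \<le> t \<and> ereal t < ?r}" "s \<le> t"
    then have "(SUP x\<in>cball x0 s. q x) \<le> (SUP x\<in>cball x0 t. q x)"
      by (intro cSUP_subset_mono bdd) auto
    then show "b s \<le> b t" by (simp add: b_def)
  qed
  moreover have "0 < b t" if "0 \<le> t" "ereal t < ?r" for t
    using q_le[of t x0] q_nonneg[of x0] that by (simp add: b_def)
  moreover have "linearized_solutions F F' C x \<noteq> {} \<and> ?d x \<le> b (norm (x - x0)) * infdist (F x) C"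
    if x: "ereal (norm (x - x0)) < ?r" for x
  proof -
    obtain r \<gamma> where r: "norm (x - x0) < r" and \<gamma>: "quasi_regular_with F F' C x0 (ereal r) \<gamma>"
      using ex[OF x] by blast
    have le: "?d x \<le> \<gamma> (norm (x - x0)) * infdist (F x) C" and ne: "linearized_solutions F F' C x \<noteq> {}"
      using \<gamma> r by (auto simp: quasi_regular_with_def)
    have "?d x \<le> q x * infdist (F x) C"
      using le by (cases "infdist (F x) C = 0") (auto simp: q_def)
    also have "\<dots> \<le> b (norm (x - x0)) * infdist (F x) C"
      using q_le[OF x order_refl] by (intro mult_right_mono infdist_nonneg) (simp add: b_def)
    finally show ?thesis using ne by simp
  qed
  ultimately show ?thesis
    unfolding quasi_regular_with_def by blast
qed

text \<open>The infimum runs over a nonempty family bounded below by 0, so it inherits the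
  properties of its members, with positivity weakened to nonnegativity. For the distance estimate,
  dividing by \<open>infdist (F x) C\<close> isolates \<open>\<gamma>\<close> before the infimum is
  taken.\<close>

lemma
  fixes F :: "'a::real_normed_vector \<Rightarrow> 'b::real_normed_vector"
    and F' :: "'a \<Rightarrow> 'a \<Rightarrow>\<^sub>L 'b" and C :: "'b set" and x0 :: 'a
  defines "r \<equiv> quasi_regular_radius F F' C x0"
  defines "\<beta> \<equiv> quasi_regular_bound F F' C x0"
  shows quasi_regular_bound_nonneg: "0 \<le> t \<Longrightarrow> ereal t < r \<Longrightarrow> 0 \<le> \<beta> t"
    and quasi_regular_bound_mono: "0 \<le> s \<Longrightarrow> s \<le> t \<Longrightarrow> ereal t < r \<Longrightarrow> \<beta> s \<le> \<beta> t"
    and linearized_solutions_nonempty: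
      "ereal (norm (x - x0)) < r \<Longrightarrow> linearized_solutions F F' C x \<noteq> {}"
    and infdist_linearized_solutions_le:
      "ereal (norm (x - x0)) < r \<Longrightarrow>
        infdist 0 (linearized_solutions F F' C x) \<le> \<beta> (norm (x - x0)) * infdist (F x) C"
proof -
  obtain \<gamma>0 where \<gamma>0: "quasi_regular_with F F' C x0 r \<gamma>0"
    unfolding r_def using ex_quasi_regular_with_radius by blast
  have \<beta>: "\<beta> t = (INF \<gamma>\<in>{\<gamma>. quasi_regular_with F F' C x0 r \<gamma>}. \<gamma> t)" for t
    unfolding \<beta>_def quasi_regular_bound_def r_def by (simp add: image_Collect)
  have lower: "c \<le> \<beta> t" if "\<And>\<gamma>. quasi_regular_with F F' C x0 r \<gamma> \<Longrightarrow> c \<le> \<gamma> t" for c t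
    unfolding \<beta> using that \<gamma>0 by (intro cINF_greatest) auto
  have pos: "0 \<le> \<gamma> t" if "quasi_regular_with F F' C x0 r \<gamma>" "0 \<le> t" "ereal t < r" for \<gamma> t
    using that by (auto simp: quasi_regular_with_def less_imp_le)
  have upper: "\<beta> t \<le> \<gamma> t" if "quasi_regular_with F F' C x0 r \<gamma>" "0 \<le> t" "ereal t < r" for \<gamma> t
    unfolding \<beta> using that pos by (intro cINF_lower bdd_belowI2[of _ 0]) auto
  show "0 \<le> t \<Longrightarrow> ereal t < r \<Longrightarrow> 0 \<le> \<beta> t"
    using lower pos by blast
  show "\<beta> s \<le> \<beta> t" if st: "0 \<le> s" "s \<le> t" "ereal t < r"
  proof (rule lower)
    fix \<gamma> assume \<gamma>: "quasi_regular_with F F' C x0 r \<gamma>"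
    have sr: "ereal s < r" using st by (meson ereal_less_eq(3) le_less_trans)
    have "\<gamma> s \<le> \<gamma> t"
      using \<gamma> st sr by (auto simp: quasi_regular_with_def mono_on_def)
    then show "\<beta> s \<le> \<gamma> t"
      using upper[OF \<gamma> st(1) sr] by linarith
  qed
  show "linearized_solutions F F' C x \<noteq> {}" if "ereal (norm (x - x0)) < r"
    using \<gamma>0 that by (auto simp: quasi_regular_with_def)
  show "infdist 0 (linearized_solutions F F' C x) \<le> \<beta> (norm (x - x0)) * infdist (F x) C"
    if x: "ereal (norm (x - x0)) < r"
  proof -
    have le: "infdist 0 (linearized_solutions F F' C x) \<le> \<gamma> (norm (x - x0)) * infdist (F x) C"
      if "quasi_regular_with F F' C x0 r \<gamma>" for \<gamma>
      using that x by (auto simp: quasi_regular_with_def)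
    show ?thesis
    proof (cases "infdist (F x) C = 0")
      case True
      then show ?thesis using le[OF \<gamma>0] by simp
    next
      case False
      then have pos: "infdist (F x) C > 0"
        using infdist_nonneg[of "F x" C] by linarith
      have "infdist 0 (linearized_solutions F F' C x) / infdist (F x) C \<le> \<beta> (norm (x - x0))"
        using le pos by (intro lower) (simp add: divide_le_eq)
      then show ?thesis using pos by (simp add: divide_le_eq)
    qed
  qed
qed

section \<open>Gauss-Newton directions and the error of linearization\<close>

text \<open>An admissible solution \<open>p\<close> of the linearized inclusion attains the global
  minimum of \<open>h\<close>, so every constrained minimizer attains it as well.\<close>

lemma GN_directions_subset_linearized_solutions:
  assumes "p \<in> linearized_solutions F F' (minimizers h) x" and "ereal (norm p) \<le> \<Delta>"
  shows "p \<in> GN_directions F F' h \<Delta> x"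
    and "GN_directions F F' h \<Delta> x \<subseteq> linearized_solutions F F' (minimizers h) x"
proof -
  have min: "h (F x + blinfun_apply (F' x) p) \<le> h y" for y
    using assms(1) by (auto simp: linearized_solutions_def minimizers_def is_arg_min_linorder)
  show "p \<in> GN_directions F F' h \<Delta> x"
    using assms(2) min by (auto simp: GN_directions_def is_arg_min_linorder)
  show "GN_directions F F' h \<Delta> x \<subseteq> linearized_solutions F F' (minimizers h) x"
  proof
    fix d assume "d \<in> GN_directions F F' h \<Delta> x"
    then have "h (F x + blinfun_apply (F' x) d) \<le> h (F x + blinfun_apply (F' x) p)"
      using assms(2) by (auto simp: GN_directions_def is_arg_min_linorder)
    then show "d \<in> linearized_solutions F F' (minimizers h) x"
      using min by (auto simp: linearized_solutions_def minimizers_def is_arg_min_linorder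
          intro: order_trans)
  qed
qed

text \<open>Increments of fixed length of a convex function grow with the base point, and increments
  from the fixed base \<open>T\<close> lie below the chord. Applied to \<open>f'\<close>, this
  replaces the actual point and step length by their scalar majorants.\<close>

lemma convex_on_increment_le:
  fixes \<phi> :: "real \<Rightarrow> real"
  assumes \<phi>: "convex_on {0..<R} \<phi>"
    and "0 \<le> a" "a \<le> T" "0 \<le> n" "n \<le> D" "0 < D" "T + D < R"
  shows "\<phi> (a + n) - \<phi> a \<le> n / D * (\<phi> (T + D) - \<phi> T)"
proof -
  have "\<phi> (a + n) - \<phi> a \<le> \<phi> (T + n) - \<phi> T"
  proof (cases "a = T")
    case False
    \<comment> \<open>Both \<open>a + n\<close> and \<open>T\<close> are convex combinations of
      \<open>a\<close> and \<open>T + n\<close>, with the weights \<open>l\<close> and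
      \<open>1 - l\<close> interchanged; adding the two convexity inequalities gives the
      claim.\<close>
    define L where "L = T + n - a"
    define l where "l = n / L"
    have L: "L > 0" using False assms by (simp add: L_def)
    have l: "0 \<le> l" "l \<le> 1" "l * L = n"
      using L assms by (auto simp: l_def L_def)
    have eq: "(1 - l) * a + l * (T + n) = a + n" "l * a + (1 - l) * (T + n) = T"
      using l(3) by (auto simp: L_def algebra_simps)
    have "\<phi> (a + n) \<le> (1 - l) * \<phi> a + l * \<phi> (T + n)"
      using convex_onD[OF \<phi> l(1,2), of a "T + n"] assms eq by simp
    moreover have "\<phi> T \<le> l * \<phi> a + (1 - l) * \<phi> (T + n)"
      using convex_onD[OF \<phi>, of "1 - l" a "T + n"] l assms eq by simp
    ultimately show ?thesis by (simp add: algebra_simps)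
  qed simp
  also have "convex_on {T..T + D} \<phi>"
    using \<phi> by (rule convex_on_subset) (use assms in auto)
  then have "\<phi> (T + n) - \<phi> T \<le> n / D * (\<phi> (T + D) - \<phi> T)"
    using convex_onD_Icc'[of T "T + D" \<phi> "T + n"] assms by (simp add: mult.commute)
  finally show ?thesis .
qed

text \<open>A mean value inequality along the segment. One factor \<open>norm d / D\<close> comes
  from the increments of \<open>f'\<close>, the other from applying the operator to
  \<open>d\<close>.\<close>

lemma linearization_error_le:
  fixes F :: "'a::real_normed_vector \<Rightarrow> 'b::real_normed_vector"
  assumes der: "\<And>x. (F has_derivative blinfun_apply (F' x)) (at x)"
    and maj: "majorant_function F' x0 R f"
    and T: "norm (x - x0) \<le> T" and D: "norm d \<le> D" "0 < D" and R: "T + D < R"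
  shows "norm (F (x + d) - F x - blinfun_apply (F' x) d)
    \<le> (norm d / D)\<^sup>2 * (f (T + D) - f T - D * ival_deriv R f T)"
proof -
  define f' where "f' = ival_deriv R f"
  define a where "a = norm (x - x0)"
  define n where "n = norm d"
  have a: "0 \<le> a" "a \<le> T" and n: "0 \<le> n" "n \<le> D" and T0: "0 \<le> T"
    using T D order_trans[OF norm_ge_zero T] by (auto simp: a_def n_def)
  have diff: "f differentiable_on {0..<R}" and conv: "convex_on {0..<R} f'"
    using maj by (auto simp: majorant_function_def f'_def)
  \<comment> \<open>\<open>p\<close> and \<open>\<psi>\<close> are the remainders of
    \<open>F\<close> and of the scaled \<open>f\<close> after the fraction \<open>\<tau>\<close> of
    the step; \<open>p'\<close> and \<open>\<psi>'\<close> are their derivatives.\<close>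
  define p where "p = (\<lambda>\<tau>. F (x + \<tau> *\<^sub>R d) - F x - \<tau> *\<^sub>R blinfun_apply (F' x) d)"
  define p' where "p' = (\<lambda>\<tau>. blinfun_apply (F' (x + \<tau> *\<^sub>R d)) d - blinfun_apply (F' x) d)"
  define \<psi> where "\<psi> = (\<lambda>\<tau>. (n / D)\<^sup>2 * (f (T + \<tau> * D) - f T - \<tau> * D * f' T))"
  define \<psi>' where "\<psi>' = (\<lambda>\<tau>. (n / D)\<^sup>2 * (D * f' (T + \<tau> * D) - D * f' T))"
  have p: "(p has_vector_derivative p' \<tau>) (at \<tau>)" for \<tau>
  proof -
    have "((\<lambda>\<tau>. F (x + \<tau> *\<^sub>R d)) has_derivative (\<lambda>h. blinfun_apply (F' (x + \<tau> *\<^sub>R d)) (h *\<^sub>R d))) (at \<tau>)"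
      by (rule has_derivative_compose[OF _ der]) (auto intro!: derivative_eq_intros)
    then have "((\<lambda>\<tau>. F (x + \<tau> *\<^sub>R d)) has_vector_derivative blinfun_apply (F' (x + \<tau> *\<^sub>R d)) d) (at \<tau>)"
      by (simp add: has_vector_derivative_def blinfun.scaleR_right)
    then show ?thesis
      unfolding p_def p'_def by (auto intro!: derivative_eq_intros)
  qed
  have "norm (p 1 - p 0) \<le> \<psi> 1 - \<psi> 0"
  proof (rule differentiable_bound_general)
    show "continuous_on {0..1} p"
      using p has_vector_derivative_continuous continuous_at_imp_continuous_on by blast
    have "continuous_on {0..1} (\<lambda>\<tau>. f (T + \<tau> * D))"
    proof (rule continuous_on_compose2[OF differentiable_imp_continuous_on[OF diff]])
      show "continuous_on {0..1} (\<lambda>\<tau>. T + \<tau> * D)"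
        by (intro continuous_intros)
      show "(\<lambda>\<tau>. T + \<tau> * D) ` {0..1} \<subseteq> {0..<R}"
      proof (rule image_subsetI)
        fix \<tau> :: real assume "\<tau> \<in> {0..1}"
        then have "0 \<le> \<tau> * D" "\<tau> * D \<le> D"
          using D(2) by (auto intro: mult_left_le_one_le)
        then show "T + \<tau> * D \<in> {0..<R}"
          using T0 R by auto
      qed
    qed
    then show "continuous_on {0..1} \<psi>"
      unfolding \<psi>_def by (intro continuous_intros)
  next
    fix \<tau> :: real assume \<tau>: "0 < \<tau>" "\<tau> < 1"
    have \<tau>D: "0 < \<tau> * D" "\<tau> * D < D"
      using \<tau> D(2) by auto
    show "(p has_vector_derivative p' \<tau>) (at \<tau>)"
      by (rule p)
    have "(f has_real_derivative f' (T + \<tau> * D)) (at (T + \<tau> * D) within {0..<R})"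
      unfolding f'_def using T0 \<tau>D R by (intro has_real_derivative_ival_deriv[OF diff]) simp
    \<comment> \<open>As \<open>\<tau>\<close> is positive, the point is interior and the derivative
      becomes two-sided.\<close>
    then have "(f has_real_derivative f' (T + \<tau> * D)) (at (T + \<tau> * D) within {0<..<R})"
      by (rule has_field_derivative_subset) auto
    then have fd: "(f has_real_derivative f' (T + \<tau> * D)) (at (T + \<tau> * D))"
      using at_within_open[of "T + \<tau> * D" "{0<..<R}"] T0 \<tau>D R by simp
    have "((\<lambda>\<tau>. f (T + \<tau> * D)) has_real_derivative f' (T + \<tau> * D) * D) (at \<tau>)"
      by (rule DERIV_chain2[where g = "\<lambda>\<tau>. T + \<tau> * D", OF fd]) (auto intro!: derivative_eq_intros)
    then have "(\<psi> has_real_derivative \<psi>' \<tau>) (at \<tau>)"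
      unfolding \<psi>_def \<psi>'_def by (auto intro!: derivative_eq_intros)
    then show "(\<psi> has_vector_derivative \<psi>' \<tau>) (at \<tau>)"
      by (simp add: has_real_derivative_iff_has_vector_derivative)
    let ?y = "x + \<tau> *\<^sub>R d"
    have \<tau>n: "0 \<le> \<tau> * n" "\<tau> * n \<le> \<tau> * D"
      using \<tau> n by (auto intro: mult_left_mono)
    have yx: "norm (?y - x) = \<tau> * n"
      using \<tau> by (simp add: n_def)
    have s: "a + \<tau> * n < R"
      using a \<tau>n \<tau>D R by linarith
    have "norm (?y - x0) \<le> a + \<tau> * n"
      using norm_triangle_ineq[of "x - x0" "\<tau> *\<^sub>R d"] \<tau> by (simp add: a_def n_def algebra_simps)
    then have "norm (?y - x0) < R" and "norm (x - x0) < R"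
      using s \<tau>n unfolding a_def by linarith+
    then have y: "?y \<in> ball x0 R" and xb: "x \<in> ball x0 R"
      by (simp_all add: dist_norm norm_minus_commute)
    have "norm (x - x0) + norm (?y - x) < R"
      using s unfolding yx a_def .
    then have "norm (F' ?y - F' x) \<le> f' (norm (?y - x) + norm (x - x0)) - f' (norm (x - x0))"
      using maj y xb unfolding majorant_function_def f'_def by blast
    then have "norm (F' ?y - F' x) \<le> f' (a + \<tau> * n) - f' a"
      by (simp only: yx a_def[symmetric] add.commute)
    also have "\<dots> \<le> (\<tau> * n) / (\<tau> * D) * (f' (T + \<tau> * D) - f' T)"
      using a \<tau>n \<tau>D R by (intro convex_on_increment_le[OF conv]) auto
    also have "\<dots> = n / D * (f' (T + \<tau> * D) - f' T)"
      using \<tau> by simp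
    finally have F': "norm (F' ?y - F' x) \<le> n / D * (f' (T + \<tau> * D) - f' T)" .
    have "norm (p' \<tau>) \<le> norm (F' ?y - F' x) * n"
      unfolding p'_def n_def blinfun.diff_left[symmetric] by (rule norm_blinfun)
    also have "\<dots> \<le> n / D * (f' (T + \<tau> * D) - f' T) * n"
      using F' n by (intro mult_right_mono)
    also have "\<dots> = \<psi>' \<tau>"
      using D(2) by (simp add: \<psi>'_def power2_eq_square field_simps)
    finally show "norm (p' \<tau>) \<le> \<psi>' \<tau>" .
  qed simp
  then show ?thesis
    by (simp add: p_def \<psi>_def n_def f'_def)
qed

section \<open>Limits of majorized sequences and closedness of the minimizers\<close>

text \<open>Telescoping keeps the sequence in a compact ball. The error bound passes to the limit of
  a convergent subsequence, and then forces the whole sequence to that limit.\<close>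

lemma tendsto_if_steps_le:
  fixes x :: "nat \<Rightarrow> 'a::real_normed_vector" and t :: "nat \<Rightarrow> real"
  assumes "finite B" and "span B = (UNIV :: 'a set)"
    and step: "\<And>k. norm (x (Suc k) - x k) \<le> t (Suc k) - t k"
    and "t \<longlonglongrightarrow> r"
  obtains l where "x \<longlonglongrightarrow> l" and "\<And>k. norm (l - x k) \<le> r - t k"
proof -
  have le: "norm (x (k + n) - x k) \<le> t (k + n) - t k" for k n
  proof (induction n)
    case (Suc n)
    have "norm (x (k + Suc n) - x k) \<le> norm (x (Suc (k + n)) - x (k + n)) + norm (x (k + n) - x k)"
      using norm_triangle_ineq[of "x (Suc (k + n)) - x (k + n)" "x (k + n) - x k"] by simp
    then show ?case using step[of "k + n"] Suc.IH by simp
  qed simp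
  have "incseq t"
    using order_trans[OF norm_ge_zero step] by (intro incseq_SucI) simp
  then have "t k \<le> r" for k
    using assms(4) by (rule incseq_le)
  then have "norm (x n - x 0) \<le> r - t 0" for n
    using le[of 0 n] by (simp add: order_trans)
  then have "\<forall>n. x n \<in> cball (x 0) (r - t 0)"
    by (simp add: dist_norm norm_minus_commute)
  moreover have "seq_compact (cball (x 0) (r - t 0))"
    using compact_if_span_finite[OF assms(1,2), of "cball (x 0) (r - t 0)"]
    by (simp add: compact_eq_seq_compact_metric)
  ultimately obtain l \<phi> where \<phi>: "strict_mono \<phi>" "(x \<circ> \<phi>) \<longlonglongrightarrow> l"
    unfolding seq_compact_def by metis
  have bound: "norm (l - x k) \<le> r - t k" for k
  proof (rule LIMSEQ_le)
    show "(\<lambda>n. norm ((x \<circ> \<phi>) n - x k)) \<longlonglongrightarrow> norm (l - x k)"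
      by (intro tendsto_intros \<phi>(2))
    show "(\<lambda>n. (t \<circ> \<phi>) n - t k) \<longlonglongrightarrow> r - t k"
      using LIMSEQ_subseq_LIMSEQ[OF assms(4) \<phi>(1)] by (intro tendsto_intros)
    have "norm ((x \<circ> \<phi>) n - x k) \<le> (t \<circ> \<phi>) n - t k" if "k \<le> n" for n
    proof -
      have "k \<le> \<phi> n"
        using that seq_suble[OF \<phi>(1), of n] by simp
      then show ?thesis using le[of k "\<phi> n - k"] by simp
    qed
    then show "\<exists>N. \<forall>n\<ge>N. norm ((x \<circ> \<phi>) n - x k) \<le> (t \<circ> \<phi>) n - t k"
      by blast
  qed
  have "(\<lambda>k. r - t k) \<longlonglongrightarrow> 0"
    using tendsto_diff[OF tendsto_const[of r] assms(4)] by simp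
  moreover have "\<forall>\<^sub>F k in sequentially. norm (x k - l) \<le> r - t k"
    using bound by (simp add: norm_minus_commute)
  ultimately have "(\<lambda>k. x k - l) \<longlonglongrightarrow> 0"
    by (rule Lim_null_comparison[rotated])
  then show ?thesis
    using that bound LIM_zero_cancel by blast
qed

text \<open>The set is a sublevel set of \<open>h\<close>, which is continuous because it is convex
  and bounded below by its minimum.\<close>

lemma closed_minimizers:
  fixes B :: "'b::real_normed_vector set" and h :: "'b \<Rightarrow> real"
  assumes "finite B" and "span B = UNIV" and "convex_on UNIV h" and "minimizers h \<noteq> {}"
  shows "closed (minimizers h)"
proof -
  obtain y0 where y0: "\<And>y. h y0 \<le> h y"
    using assms(4) by (auto simp: minimizers_def is_arg_min_linorder)
  then have eq: "minimizers h = {y. h y \<le> h y0}"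
    by (auto simp: minimizers_def is_arg_min_linorder intro: order_trans)
  show ?thesis
    unfolding eq
    using continuous_on_convex_if_span_finite[OF assms(1-3) y0]
    by (intro closed_Collect_le continuous_on_const) auto
qed

section \<open>Majorization of the Gauss-Newton iterates\<close>

text \<open>A shortest solution \<open>p\<close> of the linearized inclusion exists; since
  \<open>\<eta>\<close> is at least 1, its length is at most \<open>e\<close> and hence at most
  \<Delta>. So \<open>p\<close> is itself a Gauss-Newton direction, and the chosen \<open>d\<close>
  has length at most \<open>\<eta> * norm p\<close>.\<close>

lemma GN_step_le:
  fixes F :: "'a::real_normed_vector \<Rightarrow> 'b::real_normed_vector" and B :: "'a set"
  assumes "finite B" and "span B = UNIV" and cl: "closed (minimizers h)"
    and ne: "linearized_solutions F F' (minimizers h) x \<noteq> {}"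
    and \<eta>: "1 \<le> \<eta>" and e: "\<eta> * infdist 0 (linearized_solutions F F' (minimizers h) x) \<le> e"
    and \<Delta>: "ereal e \<le> \<Delta>"
    and d: "d \<in> GN_directions F F' h \<Delta> x"
      "norm d \<le> \<eta> * infdist 0 (GN_directions F F' h \<Delta> x)"
  shows "F x + blinfun_apply (F' x) d \<in> minimizers h" and "norm d \<le> e"
proof -
  let ?D = "linearized_solutions F F' (minimizers h) x"
  have "?D = (\<lambda>d. F x + blinfun_apply (F' x) d) -` minimizers h"
    by (auto simp: linearized_solutions_def)
  then have "closed ?D"
    using cl by (auto intro!: continuous_closed_vimage continuous_intros)
  then obtain p where p: "p \<in> ?D" "infdist 0 ?D = norm p"
    using infdist_attained_if_span_finite[OF assms(1,2) _ ne, of 0] by auto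
  have "norm p \<le> \<eta> * norm p"
    using \<eta> mult_right_mono[of 1 \<eta> "norm p"] by simp
  then have "ereal (norm p) \<le> \<Delta>"
    using e p(2) \<Delta> by (metis ereal_less_eq(3) order_trans)
  note GN = GN_directions_subset_linearized_solutions[OF p(1) this]
  show "F x + blinfun_apply (F' x) d \<in> minimizers h"
    using GN(2) d(1) by (auto simp: linearized_solutions_def)
  have "\<eta> * infdist 0 (GN_directions F F' h \<Delta> x) \<le> \<eta> * norm p"
    using infdist_le[OF GN(1), of 0] \<eta> by (intro mult_left_mono) auto
  then show "norm d \<le> e"
    using d(2) e p(2) by simp
qed

text \<open>The first three claims form the induction invariant \<open>P\<close>. The fourth is the
  finer estimate obtained within the induction step, before it is weakened to the third.\<close>

lemma GN_sequence_majorized: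
  fixes F :: "'a::real_normed_vector \<Rightarrow> 'b::real_normed_vector" and B :: "'a set"
    and F' :: "'a \<Rightarrow> 'a \<Rightarrow>\<^sub>L 'b" and h :: "'b \<Rightarrow> real"
  defines "C \<equiv> minimizers h"
  assumes newton: "newton_convex_deriv g g' R r t"
    and B: "finite B" "span B = UNIV"
    and der: "\<And>x. (F has_derivative blinfun_apply (F' x)) (at x)"
    and maj: "majorant_function F' x0 R f"
    and \<alpha>: "0 < \<alpha>"
    and g: "\<And>s. g s = \<xi> + (\<alpha> - 1) * s + \<alpha> * f s"
    and g': "\<And>s. s \<in> {0..<R} \<Longrightarrow> g' s = \<alpha> - 1 + \<alpha> * ival_deriv R f s"
    and \<eta>: "1 \<le> \<eta>" and C: "closed C" "C \<noteq> {}"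
    and radius: "\<And>s. s < r \<Longrightarrow> ereal s < quasi_regular_radius F F' C x0"
    and \<Delta>: "ereal \<xi> \<le> \<Delta>"
    and \<xi>: "\<eta> * quasi_regular_bound F F' C x0 0 * infdist (F x0) C \<le> \<xi>"
    and bound: "\<And>s. \<xi> \<le> s \<Longrightarrow> s < r \<Longrightarrow>
      \<eta> * quasi_regular_bound F F' C x0 s
        / (\<eta> * quasi_regular_bound F F' C x0 s * (ival_deriv R f s + 1) + 1) \<le> \<alpha>"
    and x: "GN_sequence F F' h \<Delta> \<eta> x0 x"
  shows "norm (x k - x0) \<le> t k"
    and "F (x k) + blinfun_apply (F' (x k)) (x (Suc k) - x k) \<in> C"
    and "norm (x (Suc k) - x k) \<le> t (Suc k) - t k"
    and "1 \<le> k \<Longrightarrow> norm (x (Suc k) - x k)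
      \<le> (t (Suc k) - t k) / (t k - t (k - 1))\<^sup>2 * (norm (x k - x (k - 1)))\<^sup>2"
proof -
  interpret newton_convex_deriv g g' R r t by (rule newton)
  let ?\<beta> = "quasi_regular_bound F F' C x0"
  let ?D = "\<lambda>k. linearized_solutions F F' C (x k)"
  let ?n = "\<lambda>k. norm (x (Suc k) - x k)"
  let ?T = "\<lambda>k. t (Suc k) - t k"
  define P where "P = (\<lambda>k. norm (x k - x0) \<le> t k
    \<and> F (x k) + blinfun_apply (F' (x k)) (x (Suc k) - x k) \<in> C \<and> ?n k \<le> ?T k)"
  have x_0: "x 0 = x0" and step: "x (Suc k) - x k \<in> GN_directions F F' h \<Delta> (x k)"
      "?n k \<le> \<eta> * infdist 0 (GN_directions F F' h \<Delta> (x k))" for k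
    using x by (auto simp: GN_sequence_def)
  have f_0: "f 0 = 0" and f'_0: "ival_deriv R f 0 = -1"
    and f'_mono: "strict_mono_on {0..<R} (ival_deriv R f)"
    using maj by (auto simp: majorant_function_def)
  \<comment> \<open>Here \<open>g 0 = \<xi>\<close> and \<open>g'\<close> takes the value -1 at
    0.\<close>
  have t_1: "t (Suc 0) = \<xi>"
    using t_Suc[of 0] t_0 g[of 0] g'[of 0] f_0 f'_0 r_pos r_less by simp
  have T_pos: "0 < ?T k" for k
    using t_less_Suc[of k] by simp
  have T_\<Delta>: "ereal (?T k) \<le> \<Delta>" for k
    using t_step_le_first[of k] t_1 \<Delta> by (metis One_nat_def ereal_less_eq(3) order_trans)
  \<comment> \<open>The bound \<open>e\<close> is left free: it will be \<xi> for the first step and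
    the quadratic bound for later ones.\<close>
  have one_step: "F (x k) + blinfun_apply (F' (x k)) (x (Suc k) - x k) \<in> C \<and> ?n k \<le> e"
    if "norm (x k - x0) \<le> t k" and e: "\<eta> * infdist 0 (?D k) \<le> e" "e \<le> ?T k" for k e
  proof -
    have "norm (x k - x0) < r"
      using that(1) t_bounds[of k] by linarith
    then have "?D k \<noteq> {}"
      by (rule linearized_solutions_nonempty[OF radius])
    moreover have "ereal e \<le> \<Delta>"
      using e(2) T_\<Delta>[of k] by (metis ereal_less_eq(3) order_trans)
    ultimately show ?thesis
      using GN_step_le[OF B C(1)[unfolded C_def] _ \<eta> _ _ step] e(1) by (simp add: C_def)
  qed
  have Suc_step: "norm (x (Suc k) - x0) \<le> t (Suc k)
      \<and> \<eta> * infdist 0 (?D (Suc k)) \<le> ?T (Suc k) / (?T k)\<^sup>2 * (?n k)\<^sup>2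
      \<and> ?T (Suc k) / (?T k)\<^sup>2 * (?n k)\<^sup>2 \<le> ?T (Suc k)" if P: "P k" for k
  proof (intro conjI)
    let ?s = "t (Suc k)"
    define q where "q = (?n k / ?T k)\<^sup>2"
    \<comment> \<open>Because \<open>t (Suc 0) = \<xi>\<close>, every later \<open>t\<close> value
      lies in the range where \<alpha> is bounded below by hypothesis.\<close>
    have s: "0 \<le> ?s" "?s < r" "\<xi> \<le> ?s" "?s \<in> {0..<R}" "t k \<in> {0..<R}"
      using t_bounds[of "Suc k"] t_bounds[of k] r_less strict_mono_t[THEN strict_mono_mono] t_1
      by (auto simp: monotone_def)
    have nk: "norm (x k - x0) \<le> t k" "?n k \<le> ?T k"
      and Ck: "F (x k) + blinfun_apply (F' (x k)) (x (Suc k) - x k) \<in> C"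
      using P by (auto simp: P_def)
    have q: "0 \<le> q" "q \<le> 1"
      unfolding q_def using nk(2) T_pos[of k] by (auto intro!: power_le_one)
    have q_eq: "?T (Suc k) / (?T k)\<^sup>2 * (?n k)\<^sup>2 = q * ?T (Suc k)"
      by (simp add: q_def power_divide)
    show xs: "norm (x (Suc k) - x0) \<le> ?s"
      using norm_triangle_ineq[of "x (Suc k) - x k" "x k - x0"] nk by simp
    show "?T (Suc k) / (?T k)\<^sup>2 * (?n k)\<^sup>2 \<le> ?T (Suc k)"
      unfolding q_eq using q T_pos[of "Suc k"] by (intro mult_left_le_one_le) auto
    have "infdist (F (x (Suc k))) C
        \<le> dist (F (x (Suc k))) (F (x k) + blinfun_apply (F' (x k)) (x (Suc k) - x k))"
      by (rule infdist_le[OF Ck])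
    also have "\<dots> = norm (F (x k + (x (Suc k) - x k)) - F (x k)
        - blinfun_apply (F' (x k)) (x (Suc k) - x k))"
      by (simp add: dist_norm algebra_simps)
    also have "\<dots> \<le> q * (f (t k + ?T k) - f (t k) - ?T k * ival_deriv R f (t k))"
      unfolding q_def using nk T_pos[of k] s
      by (intro linearization_error_le[OF der maj]) auto
    also have "\<dots> = q * (g ?s / \<alpha>)"
    proof -
      \<comment> \<open>The Newton equation eliminates the value and the slope of \<open>g\<close>
        at \<open>t k\<close>; the affine parts cancel and only the remainder of \<open>f\<close>
        times \<alpha> is left.\<close>
      have "g (t k) + g' (t k) * ?T k = 0"
        using t_Suc[of k] deriv_t_neg[of k] by simp
      moreover have "g (t k) = \<xi> + (\<alpha> - 1) * t k + \<alpha> * f (t k)"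
        and "g' (t k) = \<alpha> - 1 + \<alpha> * ival_deriv R f (t k)"
        and "g ?s = \<xi> + (\<alpha> - 1) * ?s + \<alpha> * f ?s"
        using g g' s by auto
      ultimately have "g ?s = \<alpha> * (f ?s - f (t k) - ?T k * ival_deriv R f (t k))"
        by (simp add: algebra_simps)
      then show ?thesis using \<alpha> by simp
    qed
    finally have FC: "infdist (F (x (Suc k))) C \<le> q * (g ?s / \<alpha>)" .
    have \<beta>_nonneg: "0 \<le> ?\<beta> ?s"
      using s radius by (intro quasi_regular_bound_nonneg) auto
    have gs: "0 < g ?s" "g' ?s < 0"
      using pos s deriv_t_neg by auto
    have "infdist 0 (?D (Suc k)) \<le> ?\<beta> (norm (x (Suc k) - x0)) * infdist (F (x (Suc k))) C"
      using xs s radius by (intro infdist_linearized_solutions_le) auto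
    also have "\<dots> \<le> ?\<beta> ?s * infdist (F (x (Suc k))) C"
      using xs s radius
      by (intro mult_right_mono quasi_regular_bound_mono infdist_nonneg) auto
    also have "\<dots> \<le> ?\<beta> ?s * (q * (g ?s / \<alpha>))"
      using FC \<beta>_nonneg by (rule mult_left_mono)
    finally have "\<eta> * infdist 0 (?D (Suc k)) \<le> \<eta> * (?\<beta> ?s * (q * (g ?s / \<alpha>)))"
      by (rule mult_left_mono) (use \<eta> in simp)
    then have D: "\<eta> * infdist 0 (?D (Suc k)) \<le> \<eta> * ?\<beta> ?s * (q * (g ?s / \<alpha>))"
      by (simp only: mult.assoc)
    \<comment> \<open>In these terms the bound on \<alpha> reads
      \<open>b / (b * y + 1) \<le> \<alpha>\<close>, and \<open>g' ?s = \<alpha> * y - 1\<close>.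
      Since \<open>y\<close> is nonnegative, the denominator is positive and can be cleared.\<close>
    define b where "b = \<eta> * ?\<beta> ?s"
    define y where "y = ival_deriv R f ?s + 1"
    have b: "0 \<le> b" using \<eta> \<beta>_nonneg by (simp add: b_def)
    have "0 < ?s" using s t_bounds[of k] t_less_Suc[of k] by linarith
    then have "ival_deriv R f 0 < ival_deriv R f ?s"
      using s r_pos r_less by (intro strict_mono_onD[OF f'_mono]) auto
    then have "0 \<le> y"
      using f'_0 by (simp add: y_def)
    then have "0 < b * y + 1" using b by (simp add: add_nonneg_pos)
    moreover have "b / (b * y + 1) \<le> \<alpha>"
      using bound[OF s(3,2)] by (simp add: b_def y_def)
    ultimately have "b \<le> \<alpha> * (b * y + 1)"
      by (simp add: pos_divide_le_eq)
    then have "b * - (\<alpha> * y - 1) \<le> \<alpha>"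
      by (simp add: algebra_simps)
    moreover have "g' ?s = \<alpha> * y - 1"
      using g'[OF s(4)] by (simp add: y_def algebra_simps)
    ultimately have "b * - g' ?s \<le> \<alpha>"
      by (simp only:)
    then have "b / \<alpha> \<le> 1 / - g' ?s"
      using \<alpha> gs(2) by (simp add: field_simps)
    then have "b / \<alpha> * (q * g ?s) \<le> 1 / - g' ?s * (q * g ?s)"
      using q gs by (intro mult_right_mono) auto
    also have "\<dots> = q * ?T (Suc k)"
      using t_Suc[of "Suc k"] by simp
    finally show "\<eta> * infdist 0 (?D (Suc k)) \<le> ?T (Suc k) / (?T k)\<^sup>2 * (?n k)\<^sup>2"
      unfolding q_eq using D by (simp add: b_def)
  qed
  have P: "P k" for k
  proof (induction k)
    case 0
    have "infdist 0 (?D 0) \<le> ?\<beta> (norm (x 0 - x0)) * infdist (F (x 0)) C"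
      using r_pos radius x_0 by (intro infdist_linearized_solutions_le) auto
    then have "\<eta> * infdist 0 (?D 0) \<le> \<eta> * (?\<beta> 0 * infdist (F x0) C)"
      using \<eta> x_0 by (intro mult_left_mono) auto
    then have "\<eta> * infdist 0 (?D 0) \<le> \<xi>"
      using \<xi> by (simp add: mult.assoc)
    then show ?case
      using one_step[of 0 \<xi>] x_0 t_0 t_1 by (simp add: P_def)
  next
    case (Suc k)
    show ?case
      using Suc_step[OF Suc] one_step[of "Suc k"] unfolding P_def by (meson order_trans)
  qed
  then show "norm (x k - x0) \<le> t k"
    and "F (x k) + blinfun_apply (F' (x k)) (x (Suc k) - x k) \<in> C"
    and "norm (x (Suc k) - x k) \<le> t (Suc k) - t k"
    unfolding P_def by blast+
  show "norm (x (Suc k) - x k) \<le> (t (Suc k) - t k) / (t k - t (k - 1))\<^sup>2 * (norm (x k - x (k - 1)))\<^sup>2"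
    if k: "1 \<le> k"
  proof -
    obtain j where "k = Suc j" using k by (cases k) auto
    then show ?thesis
      using Suc_step[OF P[of j]] one_step[of "Suc j"] by simp
  qed
qed

section \<open>Transfer of the scalar convergence to the Gauss-Newton sequence\<close>

theorem theorem12:
  fixes F :: "'a::real_normed_vector \<Rightarrow> 'b::real_normed_vector"
    and F' :: "'a \<Rightarrow> 'a \<Rightarrow>\<^sub>L 'b"
    and basis_a :: "'a set" and basis_b :: "'b set"
    and x0 :: 'a and R \<alpha> \<xi> t_star :: real
    and f g :: "real \<Rightarrow> real" and t :: "nat \<Rightarrow> real"
  assumes "finite_dimensional_vector_space (scaleR :: real \<Rightarrow> 'a \<Rightarrow> 'a) basis_a"
    and "finite_dimensional_vector_space (scaleR :: real \<Rightarrow> 'b \<Rightarrow> 'b) basis_b"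
    and "\<And>x. (F has_derivative blinfun_apply (F' x)) (at x)"
    and "continuous_on UNIV F'"
    and "R > 0"
    and "majorant_function F' x0 R f"
    and "\<alpha> > 0" and "\<xi> > 0"
    and g_def: "g = (\<lambda>s. \<xi> + (\<alpha> - 1) * s + \<alpha> * f s)"
    and "0 < t_star" and "t_star < R"
    and "\<And>s. 0 < s \<Longrightarrow> s < t_star \<Longrightarrow> g s > 0"
    and "g t_star = 0"
    and "t 0 = 0"
    and "\<And>k. t (Suc k) = t k - g (t k) / ival_deriv R g (t k)"
  shows
    "(\<forall>k. t k \<in> {0..<R} \<and> ival_deriv R g (t k) \<noteq> 0) \<and>
     strict_mono t \<and> range t \<subseteq> {0..<t_star} \<and> t \<longlonglongrightarrow> t_star \<and> Q_linear t t_star \<and>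
     (\<forall>(\<eta>::real) (\<Delta>::ereal) (h :: 'b \<Rightarrow> real) C \<beta>.
        1 \<le> \<eta> \<and> 0 < \<Delta> \<and> convex_on UNIV h \<and> C = minimizers h \<and> C \<noteq> {} \<and>
        quasi_regular_point F F' C x0 \<and> \<beta> = quasi_regular_bound F F' C x0 \<and>
        infdist (F x0) C > 0 \<and> ereal t_star \<le> quasi_regular_radius F F' C x0 \<and>
        \<Delta> \<ge> ereal \<xi> \<and> \<xi> \<ge> \<eta> * \<beta> 0 * infdist (F x0) C \<and>
        ereal \<alpha> \<ge>
          (SUP s \<in> {\<xi>..<t_star}. ereal (\<eta> * \<beta> s / (\<eta> * \<beta> s * (ival_deriv R f s + 1) + 1)))
      \<longrightarrow>
        (\<forall>x. GN_sequence F F' h \<Delta> \<eta> x0 x \<longrightarrow>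
           range x \<subseteq> ball x0 t_star \<and>
           (\<forall>k. F (x k) + blinfun_apply (F' (x k)) (x (Suc k) - x k) \<in> C) \<and>
           (\<forall>k. norm (x (Suc k) - x k) \<le> t (Suc k) - t k) \<and>
           (\<forall>k\<ge>1. norm (x (Suc k) - x k)
              \<le> (t (Suc k) - t k) / (t k - t (k - 1))\<^sup>2 * (norm (x k - x (k - 1)))\<^sup>2) \<and>
           (\<exists>x_star \<in> cball x0 t_star. x \<longlonglongrightarrow> x_star \<and> F x_star \<in> C \<and>
              (\<forall>k. norm (x_star - x k) \<le> t_star - t k) \<and>
              R_linear x x_star \<and>
              (ival_deriv R g t_star < 0 \<longrightarrow> R_quadratic x x_star))) \<and>
        (ival_deriv R g t_star < 0 \<longrightarrow> Q_quadratic t t_star))"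
proof -
  note maj = assms(6)
  let ?f' = "ival_deriv R f" and ?g' = "ival_deriv R g"
  have B: "finite basis_a" "span basis_a = (UNIV :: 'a set)"
      "finite basis_b" "span basis_b = (UNIV :: 'b set)"
    using finite_dimensional_vector_space.finite_Basis[OF assms(1)]
      finite_dimensional_vector_space.span_Basis[OF assms(1)]
      finite_dimensional_vector_space.finite_Basis[OF assms(2)]
      finite_dimensional_vector_space.span_Basis[OF assms(2)]
    by (simp_all add: span_raw_def)
  have f: "f differentiable_on {0..<R}" "f 0 = 0" "?f' 0 = -1"
      "convex_on {0..<R} ?f'" "strict_mono_on {0..<R} ?f'"
    using maj by (auto simp: majorant_function_def)
  have g_deriv: "(g has_real_derivative \<alpha> - 1 + \<alpha> * ?f' s) (at s within {0..<R})"
    if "s \<in> {0..<R}" for s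
    unfolding g_def using has_real_derivative_ival_deriv[OF f(1) that]
    by (auto intro!: derivative_eq_intros)
  then have g': "?g' s = \<alpha> - 1 + \<alpha> * ?f' s" if "s \<in> {0..<R}" for s
    using ival_deriv_eq that by blast
  \<comment> \<open>The derivative of \<open>g\<close> is an affine function of \<open>f'\<close>
    with positive slope \<alpha>, so convexity and strict monotonicity carry over.\<close>
  have newton: "newton_convex_deriv g ?g' R t_star t"
  proof
    show "(g has_real_derivative ?g' s) (at s within {0..<R})" if "s \<in> {0..<R}" for s
      using g_deriv[OF that] g'[OF that] by simp
    show "convex_on {0..<R} ?g'"
    proof (rule convex_onI)
      fix l u v :: real assume l: "0 < l" "l < 1" and uv: "u \<in> {0..<R}" "v \<in> {0..<R}"
      let ?w = "(1 - l) *\<^sub>R u + l *\<^sub>R v"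
      have w: "?w \<in> {0..<R}"
        using convexD_alt[OF convex_on_imp_convex[OF f(4)] uv, of l] l by simp
      have "\<alpha> * ?f' ?w \<le> \<alpha> * ((1 - l) * ?f' u + l * ?f' v)"
        using convex_onD[OF f(4) _ _ uv, of l] l \<open>\<alpha> > 0\<close> by (intro mult_left_mono) auto
      then show "?g' ?w \<le> (1 - l) * ?g' u + l * ?g' v"
        unfolding g'[OF w] g'[OF uv(1)] g'[OF uv(2)] by (simp add: algebra_simps)
    qed (rule convex_on_imp_convex[OF f(4)])
    show "strict_mono_on {0..<R} ?g'"
      using f(5) g' \<open>\<alpha> > 0\<close> by (auto simp: strict_mono_on_def)
    show "0 < g s" if "0 \<le> s" "s < t_star" for s
      using assms(12)[of s] that f(2) \<open>\<xi> > 0\<close> by (cases "s = 0") (auto simp: g_def)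
  qed (use assms in auto)
  then interpret newton_convex_deriv g ?g' R t_star t .
  have t_well_defined: "\<forall>k. t k \<in> {0..<R} \<and> ?g' (t k) \<noteq> 0"
  proof (intro allI conjI)
    fix k
    show "t k \<in> {0..<R}" using t_bounds[of k] \<open>t_star < R\<close> by simp
    show "?g' (t k) \<noteq> 0" using deriv_t_neg[of k] by simp
  qed
  have range_t: "range t \<subseteq> {0..<t_star}"
    using t_bounds by auto
  have GN: "range x \<subseteq> ball x0 t_star \<and>
      (\<forall>k. F (x k) + blinfun_apply (F' (x k)) (x (Suc k) - x k) \<in> C) \<and>
      (\<forall>k. norm (x (Suc k) - x k) \<le> t (Suc k) - t k) \<and>
      (\<forall>k\<ge>1. norm (x (Suc k) - x k)
         \<le> (t (Suc k) - t k) / (t k - t (k - 1))\<^sup>2 * (norm (x k - x (k - 1)))\<^sup>2) \<and>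
      (\<exists>x_star \<in> cball x0 t_star. x \<longlonglongrightarrow> x_star \<and> F x_star \<in> C \<and>
         (\<forall>k. norm (x_star - x k) \<le> t_star - t k) \<and>
         R_linear x x_star \<and> (?g' t_star < 0 \<longrightarrow> R_quadratic x x_star))"
    if \<eta>: "1 \<le> \<eta>" and h: "convex_on UNIV h" and C: "C = minimizers h" "C \<noteq> {}"
      and rad: "ereal t_star \<le> quasi_regular_radius F F' C x0"
      and \<Delta>: "ereal \<xi> \<le> \<Delta>"
      and \<xi>: "\<eta> * quasi_regular_bound F F' C x0 0 * infdist (F x0) C \<le> \<xi>"
      and sup: "(SUP s \<in> {\<xi>..<t_star}. ereal (\<eta> * quasi_regular_bound F F' C x0 s
        / (\<eta> * quasi_regular_bound F F' C x0 s * (?f' s + 1) + 1))) \<le> ereal \<alpha>"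
      and x: "GN_sequence F F' h \<Delta> \<eta> x0 x"
    for \<eta> :: real and \<Delta> :: ereal and h :: "'b \<Rightarrow> real" and C x
  proof -
    have clC: "closed C"
      using closed_minimizers[OF B(3,4) h] C by simp
    have radius: "ereal s < quasi_regular_radius F F' C x0" if "s < t_star" for s
      using rad that by (meson ereal_less(2) ereal_less_eq(3) less_ereal.simps(1) less_le_trans)
    have bound: "\<eta> * quasi_regular_bound F F' C x0 s
        / (\<eta> * quasi_regular_bound F F' C x0 s * (?f' s + 1) + 1) \<le> \<alpha>"
      if "\<xi> \<le> s" "s < t_star" for s
      using sup that unfolding SUP_le_iff by simp
    note maj_seq = GN_sequence_majorized[OF newton B(1,2) assms(3) maj \<open>\<alpha> > 0\<close>
        g_def[THEN fun_cong] g' \<eta> clC[unfolded C(1)] C(2)[unfolded C(1)]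
        radius[unfolded C(1)] \<Delta> \<xi>[unfolded C(1)] bound[unfolded C(1)] x, folded C(1)]
    obtain l where l: "x \<longlonglongrightarrow> l" "\<And>k. norm (l - x k) \<le> t_star - t k"
      using tendsto_if_steps_le[OF B(1,2) maj_seq(3) t_tendsto] by blast
    have "x k \<in> ball x0 t_star" for k
      using maj_seq(1)[of k] t_bounds[of k] by (simp add: dist_norm norm_minus_commute)
    then have ball: "range x \<subseteq> ball x0 t_star"
      by blast
    have l_cball: "l \<in> cball x0 t_star"
      using l(2)[of 0] x \<open>t 0 = 0\<close> by (simp add: GN_sequence_def dist_norm norm_minus_commute)
    \<comment> \<open>The linearized values lie in the closed set \<open>C\<close>, and they
      converge to \<open>F l\<close> because the steps tend to 0.\<close>
    have Fl: "F l \<in> C"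
    proof (rule closed_sequentially[OF clC])
      show "F (x k) + blinfun_apply (F' (x k)) (x (Suc k) - x k) \<in> C" for k
        by (rule maj_seq(2))
      have "(\<lambda>k. F (x k)) \<longlonglongrightarrow> F l"
        using isCont_tendsto_compose[OF has_derivative_continuous[OF assms(3)] l(1)] .
      moreover have "(\<lambda>k. F' (x k)) \<longlonglongrightarrow> F' l"
        using continuous_on_tendsto_compose[OF assms(4) l(1)] by simp
      moreover have "(\<lambda>k. x (Suc k) - x k) \<longlonglongrightarrow> l - l"
        by (intro tendsto_diff l(1) LIMSEQ_Suc)
      ultimately have "(\<lambda>k. F (x k) + blinfun_apply (F' (x k)) (x (Suc k) - x k))
          \<longlonglongrightarrow> F l + blinfun_apply (F' l) (l - l)"
        by (intro tendsto_add blinfun.tendsto)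
      then show "(\<lambda>k. F (x k) + blinfun_apply (F' (x k)) (x (Suc k) - x k)) \<longlonglongrightarrow> F l"
        by (simp add: blinfun.zero_right)
    qed
    \<comment> \<open>The scalar error majorizes the vector error, and its rate towards 0 is that of
      \<open>t\<close> towards \<open>t_star\<close>; it witnesses both R-rates.\<close>
    let ?e = "\<lambda>k. t_star - t k"
    have e: "\<forall>k. 0 \<le> ?e k \<and> norm (x k - l) \<le> ?e k"
      using l(2) t_bounds by (auto simp: norm_minus_commute less_imp_le)
    have norm_e: "norm (?e k - 0) = norm (t k - t_star)" for k
      by (simp add: abs_minus_commute)
    have "Q_linear ?e 0"
      using Q_linear_t unfolding Q_linear_def norm_e .
    with e have lin: "R_linear x l"
      unfolding R_linear_def by (intro exI[of _ ?e] conjI)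
    have quad: "R_quadratic x l" if "?g' t_star < 0"
    proof -
      have "?e \<longlonglongrightarrow> t_star - t_star"
        by (intro tendsto_intros t_tendsto)
      then have "?e \<longlonglongrightarrow> 0"
        by simp
      then have "Q_quadratic ?e 0"
        using Q_quadratic_t[OF that] unfolding Q_quadratic_def norm_e by blast
      with e show ?thesis
        unfolding R_quadratic_def by (intro exI[of _ ?e] conjI)
    qed
    show ?thesis
      using ball maj_seq(2-4) l l_cball Fl lin quad by (intro conjI bexI[of _ l] allI impI)
  qed
  show ?thesis
    apply (rule conjI[OF t_well_defined conjI[OF strict_mono_t conjI[OF range_t
            conjI[OF t_tendsto conjI[OF Q_linear_t]]]]])
    apply (intro allI impI)
    apply (elim conjE)
    apply (rule conjI)
    subgoal for \<eta> \<Delta> h C \<beta>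
      by (intro allI impI, hypsubst, rule GN) (assumption | rule refl)+
    subgoal
      using Q_quadratic_t by (rule impI)
    done
qed

end
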